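(* Let $G=SL_3(\mathbb C)$ and let $q\in\mathbb C^*$ be not a root of unity. For every $(w_1,w_2)\in S_3\times S_3$ there exists a reduced expression $\mathbf i$ of $(w_1,w_2)$ such that $R_{\mathbf i}$ has enough pivot elements.
   Context: $\mathbb C_q[SL_3]$ is generated by $x_{ij}$, $1\le i,j\le 3$, with relations $x_{ij}x_{il}=qx_{il}x_{ij}$ ($j<l$), $x_{ij}x_{kj}=qx_{kj}x_{ij}$ ($i<k$), $x_{il}x_{kj}=x_{kj}x_{il}$ and $x_{ij}x_{kl}-x_{kl}x_{ij}=(q-q^{-1})x_{il}x_{kj}$ ($i<k$, $j<l$), and $\sum_{\tau\in S_3}(-q)^{l(\tau)}x_{1\tau(1)}x_{2\tau(2)}x_{3\tau(3)}=1$; coproduct $\Delta(x_{ij})=\sum_kx_{ik}\otimes x_{kj}$. A reduced expression of $(w_1,w_2)\in S_3\times S_3$ is $\mathbf i=(i_1,\dots,i_m)$, $m=l(w_1)+l(w_2)$, $i_k\in\{\pm1,\pm2\}$, such that the ordered product of the simple transpositions $s_{|i_k|}=(|i_k|,|i_k|+1)$ over $i_k<0$ is $w_1$ and over $i_k>0$ is $w_2$. $L_q(2)$ is generated by $x^{\pm1},y^{\pm1}$ with $xy=qyx$; $L_q(\mathbf i)=L_q(2)^{\otimes m}$, with generators $x_k^{\pm1},y_k^{\pm1}$ of the $k$-th factor and basis $x^{\mathbf a}y^{\mathbf b}=\prod_kx_k^{a_k}\prod_ky_k^{b_k}$ ($\mathbf a,\mathbf b\in\mathbb Z^m$). For each $k$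 let $\psi_k:\mathbb C_q[SL_3]\to L_q(2)$ be the algebra homomorphism with, for $h=|i_k|$: $\psi_k(x_{ii})=1$ for $i\notin\{h,h+1\}$, $\psi_k(x_{hh})=x$, $\psi_k(x_{h+1,h+1})=x^{-1}$, $\psi_k(x_{h,h+1})=y$ if $i_k>0$, $\psi_k(x_{h+1,h})=y$ if $i_k<0$, and $\psi_k(x_{ij})=0$ otherwise. $\tilde\pi_{\mathbf i}=(\psi_1\otimes\cdots\otimes\psi_m)\circ\Delta^{(m-1)}$, $R_{\mathbf i}=\tilde\pi_{\mathbf i}(\mathbb C_q[SL_3])\subset L_q(\mathbf i)$, and $S_{\mathbf i}$ is the set of elements of $R_{\mathbf i}$ that are units of $L_q(\mathbf i)$, i.e. of the form $cx^{\mathbf a}y^{\mathbf b}$ with $c\in\mathbb C^*$. Pivot elements. For $\mathbf u=\sum c_{\mathbf a,\mathbf b}x^{\mathbf a}y^{\mathbf b}\in L_q(\mathbf i)$ let $\mathrm{supp}_x(\mathbf u)=\{\mathbf a\mid\exists\mathbf b,\ c_{\mathbf a,\mathbf b}\ne0\}$; the multiplicity of $\mathbf a\in\mathrm{supp}_x(\mathbf u)$ is the number of $\mathbf b$ with $c_{\mathbf a,\mathbf b}\ne0$. $\mathrm{supp}_x(S_{\mathbf i})=\bigcup_{\mathbf u\in S_{\mathbf i}}\mathrm{supp}_x(\mathbf u)$. For $I\subset\{1,\dots,m\}$, $\mathbf c\le_I\mathbf c'$ means $c_j\le c'_j$ for all $j\in I$, and $\mathbf c<_k\mathbf c'$ means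 $c_k<c_k'$ (similarly $\ge_I$, $>_k$). $\odot$ is componentwise multiplication. For $\mathbf a\in(\mathbb Z\setminus\{0\})^m$, $I\subset\{1,\dots,m\}$, $k\in I$, an element $\mathbf u\in L_q(\mathbf i)$ is an $\mathbf a$-pivot element of type $(I,k)$ if $\mathrm{supp}_x(\mathbf u)$ has an element $\mathbf c$ of multiplicity 1 such that $\mathbf a\odot\mathbf c\le_I0$, $\mathbf a\odot\mathbf c<_k0$, and for every other $\mathbf c'\in\mathrm{supp}_x(\mathbf u)$, $\mathbf a\odot(\mathbf c'-\mathbf c)\ge_I0$ and $\mathbf a\odot(\mathbf c'-\mathbf c)>_k0$. $R_{\mathbf i}$ has enough pivot elements if for some permutation $n_1,\dots,n_m$ of $1,\dots,m$ there are, for each $1\le k\le m$, some $\mathbf a_k\in\mathrm{supp}_x(S_{\mathbf i})\cap(\mathbb Z\setminus\{0\})^m$ and an $\mathbf a_k$-pivot element $\mathbf u_k\in R_{\mathbf i}$ of type $(\{1,\dots,m\}\setminus\{n_1,\dots,n_{k-1}\},n_k)$. *)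

theory Defs
  imports
    Complex_Main
    "HOL-Algebra.QuotRing"
    "HOL-Combinatorics.Permutations"
    "HOL-Library.Poly_Mapping"
begin

section \<open>Complex algebras with a distinguished basis\<close>

text \<open>
  An element of a complex vector space with basis \<open>B\<close> is a finitely supported function
  \<open>B \<Rightarrow>\<^sub>0 complex\<close>.  All algebras below, apart from the quotient that defines the quantum group,
  are spanned by a basis that is a monoid up to scalars, \<open>e\<^sub>u e\<^sub>v = \<sigma>(u,v) e\<^sub>u\<^sub>v\<close>.
\<close>

definition smul :: "complex \<Rightarrow> ('a \<Rightarrow>\<^sub>0 complex) \<Rightarrow> ('a \<Rightarrow>\<^sub>0 complex)" where
  "smul c f = Poly_Mapping.map ((*) c) f"

definition lin_ext :: "('a \<Rightarrow> ('b \<Rightarrow>\<^sub>0 complex)) \<Rightarrow> ('a \<Rightarrow>\<^sub>0 complex) \<Rightarrow> ('b \<Rightarrow>\<^sub>0 complex)" where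
  "lin_ext \<phi> f = (\<Sum>u\<in>Poly_Mapping.keys f. smul (Poly_Mapping.lookup f u) (\<phi> u))"

definition twisted_algebra ::
    "'a monoid \<Rightarrow> ('a \<Rightarrow> 'a \<Rightarrow> complex) \<Rightarrow> ('a \<Rightarrow>\<^sub>0 complex) ring" where
  "twisted_algebra G \<sigma> =
     \<lparr>carrier = {f. Poly_Mapping.keys f \<subseteq> carrier G},
      monoid.mult = (\<lambda>f g. \<Sum>u\<in>Poly_Mapping.keys f. \<Sum>v\<in>Poly_Mapping.keys g.
        Poly_Mapping.single (u \<otimes>\<^bsub>G\<^esub> v)
          (\<sigma> u v * Poly_Mapping.lookup f u * Poly_Mapping.lookup g v)),
      one = Poly_Mapping.single \<one>\<^bsub>G\<^esub> 1,
      zero = 0,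
      add = (+)\<rparr>"

text \<open>
  The \<open>m\<close>-th tensor power of such an algebra has as basis the lists \<open>[u\<^sub>1, \<dots>, u\<^sub>m]\<close>, standing for
  \<open>e\<^bsub>u1\<^esub> \<otimes> \<dots> \<otimes> e\<^bsub>um\<^esub>\<close>, with factorwise multiplication; \<open>tensor [f\<^sub>1, \<dots>, f\<^sub>m]\<close> is
  \<open>f\<^sub>1 \<otimes> \<dots> \<otimes> f\<^sub>m\<close>.
\<close>

definition power_monoid :: "nat \<Rightarrow> 'a monoid \<Rightarrow> 'a list monoid" where
  "power_monoid m G =
     \<lparr>carrier = {us. length us = m \<and> set us \<subseteq> carrier G},
      monoid.mult = map2 (monoid.mult G),
      one = replicate m \<one>\<^bsub>G\<^esub>\<rparr>"

definition tensor_power ::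
    "nat \<Rightarrow> 'a monoid \<Rightarrow> ('a \<Rightarrow> 'a \<Rightarrow> complex) \<Rightarrow> ('a list \<Rightarrow>\<^sub>0 complex) ring" where
  "tensor_power m G \<sigma> =
     twisted_algebra (power_monoid m G) (\<lambda>us vs. prod_list (map2 \<sigma> us vs))"

definition tensor_cons ::
    "('a \<Rightarrow>\<^sub>0 complex) \<Rightarrow> ('a list \<Rightarrow>\<^sub>0 complex) \<Rightarrow> ('a list \<Rightarrow>\<^sub>0 complex)" where
  "tensor_cons f g = (\<Sum>u\<in>Poly_Mapping.keys f. \<Sum>us\<in>Poly_Mapping.keys g.
     Poly_Mapping.single (u # us) (Poly_Mapping.lookup f u * Poly_Mapping.lookup g us))"

definition tensor :: "('a \<Rightarrow>\<^sub>0 complex) list \<Rightarrow> ('a list \<Rightarrow>\<^sub>0 complex)" where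
  "tensor fs = foldr tensor_cons fs (Poly_Mapping.single [] 1)"


section \<open>The quantized coordinate ring of \<open>SL\<^sub>3\<close>\<close>

type_synonym gen = "nat \<times> nat"

definition words :: "gen list monoid" where
  "words = \<lparr>carrier = lists ({1..3} \<times> {1..3}), monoid.mult = (@), one = []\<rparr>"

definition free_alg :: "(gen list \<Rightarrow>\<^sub>0 complex) ring" where
  "free_alg = twisted_algebra words (\<lambda>_ _. 1)"

definition X :: "nat \<Rightarrow> nat \<Rightarrow> (gen list \<Rightarrow>\<^sub>0 complex)" where
  "X i j = Poly_Mapping.single [(i, j)] 1"

text \<open>The algebra homomorphism from the free algebra with prescribed values on the generators.\<close>

definition hom_ext ::
    "('b \<Rightarrow>\<^sub>0 complex) ring \<Rightarrow> (gen \<Rightarrow> ('b \<Rightarrow>\<^sub>0 complex))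
      \<Rightarrow> (gen list \<Rightarrow>\<^sub>0 complex) \<Rightarrow> ('b \<Rightarrow>\<^sub>0 complex)" where
  "hom_ext A \<phi> = lin_ext (\<lambda>w. foldr (monoid.mult A) (map \<phi> w) \<one>\<^bsub>A\<^esub>)"

text \<open>The Coxeter length of a permutation of \<open>{1,2,3}\<close> is its number of inversions.\<close>

definition perm_length :: "(nat \<Rightarrow> nat) \<Rightarrow> nat" where
  "perm_length w = card {(i, j). i \<in> {1..3} \<and> j \<in> {1..3} \<and> i < j \<and> w j < w i}"

definition quantum_det :: "complex \<Rightarrow> (gen list \<Rightarrow>\<^sub>0 complex)" where
  "quantum_det q = (\<Sum>\<tau>\<in>{\<tau>. \<tau> permutes {1..3}}. smul ((- q) ^ perm_length \<tau>)
     (X 1 (\<tau> 1) \<otimes>\<^bsub>free_alg\<^esub> X 2 (\<tau> 2) \<otimes>\<^bsub>free_alg\<^esub> X 3 (\<tau> 3)))"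

definition relators :: "complex \<Rightarrow> (gen list \<Rightarrow>\<^sub>0 complex) set" where
  "relators q =
     {X i j \<otimes>\<^bsub>free_alg\<^esub> X i l - smul q (X i l \<otimes>\<^bsub>free_alg\<^esub> X i j) | i j l.
        i \<in> {1..3} \<and> j \<in> {1..3} \<and> l \<in> {1..3} \<and> j < l}
   \<union> {X i j \<otimes>\<^bsub>free_alg\<^esub> X k j - smul q (X k j \<otimes>\<^bsub>free_alg\<^esub> X i j) | i j k.
        i \<in> {1..3} \<and> j \<in> {1..3} \<and> k \<in> {1..3} \<and> i < k}
   \<union> {X i l \<otimes>\<^bsub>free_alg\<^esub> X k j - X k j \<otimes>\<^bsub>free_alg\<^esub> X i l | i j k l.
        i \<in> {1..3} \<and> j \<in> {1..3} \<and> k \<in> {1..3} \<and> l \<in> {1..3} \<and> i < k \<and> j < l}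
   \<union> {X i j \<otimes>\<^bsub>free_alg\<^esub> X k l - X k l \<otimes>\<^bsub>free_alg\<^esub> X i j
          - smul (q - inverse q) (X i l \<otimes>\<^bsub>free_alg\<^esub> X k j) | i j k l.
        i \<in> {1..3} \<and> j \<in> {1..3} \<and> k \<in> {1..3} \<and> l \<in> {1..3} \<and> i < k \<and> j < l}
   \<union> {quantum_det q - \<one>\<^bsub>free_alg\<^esub>}"

text \<open>Two-sided ideals of \<open>free_alg\<close> are linear subspaces, since \<open>free_alg\<close> is unital.\<close>

definition Cq_SL3 :: "complex \<Rightarrow> (gen list \<Rightarrow>\<^sub>0 complex) set ring" where
  "Cq_SL3 q = free_alg Quot (Idl\<^bsub>free_alg\<^esub> (relators q))"

text \<open>
  Coproduct, counit and the iterated coproduct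
  \<open>\<Delta>\<^sup>(\<^sup>m\<^sup>-\<^sup>1\<^sup>) = (id \<otimes> \<Delta>\<^sup>(\<^sup>m\<^sup>-\<^sup>2\<^sup>)) \<circ> \<Delta>\<close> into the \<open>m\<close>-th tensor power, computed on representatives in the
  free algebra.  As usual \<open>\<Delta>\<^sup>(\<^sup>-\<^sup>1\<^sup>)\<close> is the counit; consequently \<open>iter_coproduct 1\<close> is the identity,
  up to the identification of \<open>A\<close> with its first tensor power.
\<close>

definition coproduct :: "(gen list \<Rightarrow>\<^sub>0 complex) \<Rightarrow> (gen list list \<Rightarrow>\<^sub>0 complex)" where
  "coproduct = hom_ext (tensor_power 2 words (\<lambda>_ _. 1))
     (\<lambda>(i, j). \<Sum>k\<in>{1..3}. tensor [X i k, X k j])"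

definition counit :: "(gen list \<Rightarrow>\<^sub>0 complex) \<Rightarrow> (gen list list \<Rightarrow>\<^sub>0 complex)" where
  "counit = hom_ext (tensor_power 0 words (\<lambda>_ _. 1))
     (\<lambda>(i, j). if i = j then Poly_Mapping.single [] 1 else 0)"

fun iter_coproduct :: "nat \<Rightarrow> (gen list \<Rightarrow>\<^sub>0 complex) \<Rightarrow> (gen list list \<Rightarrow>\<^sub>0 complex)" where
  "iter_coproduct 0 f = counit f"
| "iter_coproduct (Suc m) f =
     lin_ext (\<lambda>us. tensor_cons (Poly_Mapping.single (us ! 0) 1)
                     (iter_coproduct m (Poly_Mapping.single (us ! 1) 1)))
       (coproduct f)"


section \<open>The algebras \<open>L\<^sub>q(2)\<close> and \<open>L\<^sub>q(i)\<close>\<close>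

text \<open>
  The pair \<open>(a, b)\<close> stands for \<open>x\<^sup>a y\<^sup>b\<close>; since \<open>x y = q y x\<close>, one has
  \<open>(x\<^sup>a y\<^sup>b) (x\<^sup>c y\<^sup>d) = q\<^sup>-\<^sup>b\<^sup>c x\<^sup>a\<^sup>+\<^sup>c y\<^sup>b\<^sup>+\<^sup>d\<close>.
  In the tensor power, the list \<open>[(a\<^sub>1, b\<^sub>1), \<dots>, (a\<^sub>m, b\<^sub>m)]\<close> stands for
  \<open>\<Prod>\<^sub>k x\<^sub>k\<^bsup>ak\<^esup> \<Prod>\<^sub>k y\<^sub>k\<^bsup>bk\<^esup>\<close>, different tensor factors being commuting.
\<close>

definition xy_monoid :: "(int \<times> int) monoid" where
  "xy_monoid = \<lparr>carrier = UNIV, monoid.mult = (\<lambda>(a, b) (c, d). (a + c, b + d)), one = (0, 0)\<rparr>"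

definition xy_twist :: "complex \<Rightarrow> int \<times> int \<Rightarrow> int \<times> int \<Rightarrow> complex" where
  "xy_twist q = (\<lambda>(a, b) (c, d). q powi (- (b * c)))"

definition Lq2 :: "complex \<Rightarrow> (int \<times> int \<Rightarrow>\<^sub>0 complex) ring" where
  "Lq2 q = twisted_algebra xy_monoid (xy_twist q)"

definition Lq :: "complex \<Rightarrow> nat \<Rightarrow> ((int \<times> int) list \<Rightarrow>\<^sub>0 complex) ring" where
  "Lq q m = tensor_power m xy_monoid (xy_twist q)"

definition psi_gen :: "int \<Rightarrow> gen \<Rightarrow> (int \<times> int \<Rightarrow>\<^sub>0 complex)" where
  "psi_gen s = (\<lambda>(i, j). let h = nat \<bar>s\<bar> in
     if i = j then
       (if i = h then Poly_Mapping.single (1, 0) 1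
        else if i = h + 1 then Poly_Mapping.single (-1, 0) 1
        else Poly_Mapping.single (0, 0) 1)
     else if (s > 0 \<and> i = h \<and> j = h + 1) \<or> (s < 0 \<and> i = h + 1 \<and> j = h)
       then Poly_Mapping.single (0, 1) 1
     else 0)"

definition psi :: "complex \<Rightarrow> int \<Rightarrow> (gen list \<Rightarrow>\<^sub>0 complex) \<Rightarrow> (int \<times> int \<Rightarrow>\<^sub>0 complex)" where
  "psi q s = hom_ext (Lq2 q) (psi_gen s)"

definition psi_tensor ::
    "complex \<Rightarrow> int list \<Rightarrow> (gen list list \<Rightarrow>\<^sub>0 complex) \<Rightarrow> ((int \<times> int) list \<Rightarrow>\<^sub>0 complex)" where
  "psi_tensor q is =
     lin_ext (\<lambda>us. tensor (map2 (\<lambda>s u. psi q s (Poly_Mapping.single u 1)) is us))"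

text \<open>
  The map on the free algebra, and the map it induces on the quotient: every element of the
  quotient is a coset, on which the former map takes a single value.
\<close>

definition pi_free ::
    "complex \<Rightarrow> int list \<Rightarrow> (gen list \<Rightarrow>\<^sub>0 complex) \<Rightarrow> ((int \<times> int) list \<Rightarrow>\<^sub>0 complex)" where
  "pi_free q is = psi_tensor q is \<circ> iter_coproduct (length is)"

definition pi_tilde ::
    "complex \<Rightarrow> int list \<Rightarrow> (gen list \<Rightarrow>\<^sub>0 complex) set \<Rightarrow> ((int \<times> int) list \<Rightarrow>\<^sub>0 complex)" where
  "pi_tilde q is C = the_elem (pi_free q is ` C)"

definition R_alg :: "complex \<Rightarrow> int list \<Rightarrow> ((int \<times> int) list \<Rightarrow>\<^sub>0 complex) set" where
  "R_alg q is = pi_tilde q is ` carrier (Cq_SL3 q)"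

definition S_set :: "complex \<Rightarrow> int list \<Rightarrow> ((int \<times> int) list \<Rightarrow>\<^sub>0 complex) set" where
  "S_set q is = R_alg q is \<inter> Units (Lq q (length is))"


section \<open>Reduced expressions\<close>

definition simple_prod :: "int list \<Rightarrow> nat \<Rightarrow> nat" where
  "simple_prod is = foldr (\<lambda>s w. transpose (nat \<bar>s\<bar>) (nat \<bar>s\<bar> + 1) \<circ> w) is id"

definition reduced_expression :: "(nat \<Rightarrow> nat) \<Rightarrow> (nat \<Rightarrow> nat) \<Rightarrow> int list \<Rightarrow> bool" where
  "reduced_expression w1 w2 is \<longleftrightarrow>
     set is \<subseteq> {1, -1, 2, -2} \<and>
     length is = perm_length w1 + perm_length w2 \<and>
     simple_prod (filter (\<lambda>s. s < 0) is) = w1 \<and>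
     simple_prod (filter (\<lambda>s. s > 0) is) = w2"


section \<open>Pivot elements\<close>

text \<open>Exponent vectors are lists of length \<open>m\<close>, so indices range over \<open>{..<m}\<close>.\<close>

definition supp_x :: "((int \<times> int) list \<Rightarrow>\<^sub>0 complex) \<Rightarrow> int list set" where
  "supp_x u = map fst ` Poly_Mapping.keys u"

definition x_multiplicity :: "((int \<times> int) list \<Rightarrow>\<^sub>0 complex) \<Rightarrow> int list \<Rightarrow> nat" where
  "x_multiplicity u a = card {t \<in> Poly_Mapping.keys u. map fst t = a}"

definition pivot_element ::
    "int list \<Rightarrow> nat set \<Rightarrow> nat \<Rightarrow> ((int \<times> int) list \<Rightarrow>\<^sub>0 complex) \<Rightarrow> bool" where
  "pivot_element a I k u \<longleftrightarrow>
     (\<exists>c\<in>supp_x u. x_multiplicity u c = 1 \<and>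
        (\<forall>j\<in>I. a ! j * c ! j \<le> 0) \<and> a ! k * c ! k < 0 \<and>
        (\<forall>c'\<in>supp_x u - {c}.
           (\<forall>j\<in>I. a ! j * (c' ! j - c ! j) \<ge> 0) \<and> a ! k * (c' ! k - c ! k) > 0))"

definition enough_pivot_elements :: "complex \<Rightarrow> int list \<Rightarrow> bool" where
  "enough_pivot_elements q is \<longleftrightarrow>
     (let m = length is in
      \<exists>n. n permutes {..<m} \<and>
        (\<forall>k<m. \<exists>a\<in>(\<Union>v\<in>S_set q is. supp_x v). length a = m \<and> 0 \<notin> set a \<and>
           (\<exists>u\<in>R_alg q is. pivot_element a ({..<m} - n ` {..<k}) (n k) u)))"

end

theory Submission
  imports Defs
begin

text \<open>
  The map \<open>\<pi>\<^sub>i\<close> sends \<open>x\<^bsub>ij\<^esub>\<close> to the \<open>(i, j)\<close> entry of a product of \<open>m\<close> elementary matrices with entries in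
  the commuting tensor factors.  Multiplying a quantum matrix by an elementary matrix is a row operation
  that preserves the defining relations and the quantum determinant, which gives well-definedness,
  and it acts linearly on the quantum \<open>2 \<times> 2\<close> minors.  Hence every entry and every \<open>2 \<times> 2\<close> minor is a sum
  of monomials with coefficient 1, one for each path through the reduced word.  Supports are therefore
  finite combinatorial data; for each of the 36 pairs some reduced word has pivot elements among
  the entries and minors, with respect to the exponent of a product of monomial entries and minors.
\<close>

text \<open>\<open>q\<close> is a free parameter, so elements of \<open>R_alg\<close> cannot simply
  be computed. Pivot elements are therefore taken only among entries and minors: in their expansion
  each letter contributes a factor \<open>x\<close>, \<open>x^-1\<close>, \<open>y\<close> or
  \<open>1\<close> and no power of \<open>q\<close>. The coefficients are thus counts of paths, the
  same for every \<open>q\<close>, and cannot cancel. Powers of \<open>q\<close> enter only through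
  the product of monomials that supplies the vector \<open>a\<close>, where they are harmless, being
  nonzero scalars.

  Reaching these elements is the other difficulty. \<open>R_alg\<close> is defined through cosets,
  an iterated coproduct and a value picked by \<open>the_elem\<close>; before anything can be
  evaluated, \<open>pi_free\<close> has to be recognised as an algebra homomorphism that kills the
  ideal of relations.

  The pivot condition sees \<open>a\<close> only through the signs of its components, which leaves
  few cases to search. In all but one certificate the negative letters precede the positive ones;
  for the pair of two longest elements the signs alternate.\<close>

abbreviation lookup :: "('a \<Rightarrow>\<^sub>0 'b::zero) \<Rightarrow> 'a \<Rightarrow> 'b" where "lookup \<equiv> Poly_Mapping.lookup"
abbreviation single :: "'a \<Rightarrow> 'b \<Rightarrow> ('a \<Rightarrow>\<^sub>0 'b::zero)" where "single \<equiv> Poly_Mapping.single"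
abbreviation keys :: "('a \<Rightarrow>\<^sub>0 'b::zero) \<Rightarrow> 'a set" where "keys \<equiv> Poly_Mapping.keys"

section \<open>Linear maps between spaces of finitely supported functions\<close>

lemma lookup_smul [simp]: "lookup (smul c f) u = c * lookup f u"
  by (simp add: smul_def Poly_Mapping.map.rep_eq when_def)

lemma smul_simps [simp]:
  "smul c (f + g) = smul c f + smul c g"
  "smul c (f - g) = smul c f - smul c g"
  "smul c (- f) = - smul c f"
  "smul c 0 = 0"
  "smul 0 f = 0"
  "smul 1 f = f"
  "smul c (smul d f) = smul (c * d) f"
  "smul c (single u d) = single u (c * d)"
  by (rule poly_mapping_eqI; simp add: lookup_add lookup_minus lookup_single when_def algebra_simps)+

lemma smul_add_left: "smul (c + d) f = smul c f + smul d f"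
  by (rule poly_mapping_eqI) (simp add: lookup_add algebra_simps)

definition lin :: "(('a \<Rightarrow>\<^sub>0 complex) \<Rightarrow> ('b \<Rightarrow>\<^sub>0 complex)) \<Rightarrow> bool" where
  "lin F \<longleftrightarrow> (\<forall>f g. F (f + g) = F f + F g) \<and> (\<forall>c f. F (smul c f) = smul c (F f))"

lemma linI:
  "(\<And>f g. F (f + g) = F f + F g) \<Longrightarrow> (\<And>c f. F (smul c f) = smul c (F f)) \<Longrightarrow> lin F"
  by (simp add: lin_def)

lemma lin_add: "lin F \<Longrightarrow> F (f + g) = F f + F g"
  and lin_smul: "lin F \<Longrightarrow> F (smul c f) = smul c (F f)"
  by (simp_all add: lin_def)

lemma lin_0: "lin F \<Longrightarrow> F 0 = 0"
  using lin_smul[of F 0 0] by simp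

lemma lin_minus: "lin F \<Longrightarrow> F (- f) = - F f"
  using lin_add[of F f "- f"] by (simp add: lin_0 eq_neg_iff_add_eq_0 add.commute)

lemma lin_diff: "lin F \<Longrightarrow> F (f - g) = F f - F g"
  using lin_add[of F f "- g"] by (simp add: lin_minus)

lemma lin_sum: "lin F \<Longrightarrow> F (sum g A) = (\<Sum>x\<in>A. F (g x))"
  by (induction A rule: infinite_finite_induct) (simp_all add: lin_0 lin_add)

lemma lin_smul_fun: "lin (smul c)"
  by (rule linI) (simp_all add: mult.commute)

lemma lin_compose: "lin F \<Longrightarrow> lin G \<Longrightarrow> lin (\<lambda>f. F (G f))"
  by (simp add: lin_def)

lemma lin_id: "lin (\<lambda>f. f)"
  by (simp add: lin_def)

lemma lin_ext_alt:
  assumes "finite A" "keys f \<subseteq> A"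
  shows "lin_ext \<phi> f = (\<Sum>u\<in>A. smul (lookup f u) (\<phi> u))"
  unfolding lin_ext_def
  by (rule sum.mono_neutral_left) (use assms in \<open>auto simp: in_keys_iff\<close>)

lemma lin_lin_ext [simp]:
  fixes \<phi> :: "'a \<Rightarrow> ('b \<Rightarrow>\<^sub>0 complex)"
  shows "lin (lin_ext \<phi>)"
proof (rule linI)
  fix f g :: "'a \<Rightarrow>\<^sub>0 complex"
  let ?A = "keys f \<union> keys g"
  have A: "finite ?A" by simp
  show "lin_ext \<phi> (f + g) = lin_ext \<phi> f + lin_ext \<phi> g"
    using Poly_Mapping.keys_add[of f g]
    by (subst (1 2 3) lin_ext_alt[OF A])
       (auto simp: lookup_add smul_add_left sum.distrib)
next
  fix c and f :: "'a \<Rightarrow>\<^sub>0 complex"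
  have "keys (smul c f) \<subseteq> keys f"
    by (auto simp: in_keys_iff)
  then show "lin_ext \<phi> (smul c f) = smul c (lin_ext \<phi> f)"
    by (simp add: lin_ext_alt[of "keys f"] lin_sum[OF lin_smul_fun])
qed

lemma lin_ext_single [simp]: "lin_ext \<phi> (single u c) = smul c (\<phi> u)"
  by (simp add: lin_ext_def)

lemma lin_ext_singles: "lin_ext (\<lambda>u. single u 1) f = f"
proof (rule poly_mapping_eqI)
  fix v
  have "lookup (lin_ext (\<lambda>u. single u 1) f) v
      = (\<Sum>u\<in>keys f. if u = v then lookup f u else 0)"
    by (auto simp: lin_ext_def lookup_sum lookup_single when_def intro!: sum.cong)
  also have "\<dots> = lookup f v"
    by (simp add: in_keys_iff)
  finally show "lookup (lin_ext (\<lambda>u. single u 1) f) v = lookup f v" .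
qed

text \<open>Agreement is required only on basis vectors that occur in \<open>f\<close>. This admits
  laws known only for basis elements in the carrier, such as associativity. Multilinear identities
  follow by one application for each argument.\<close>

lemma lin_eq_on:
  assumes "lin F" "lin G"
    and "\<And>u. u \<in> keys f \<Longrightarrow> F (single u 1) = G (single u 1)"
  shows "F f = G f"
proof -
  have *: "H f = (\<Sum>u\<in>keys f. smul (lookup f u) (H (single u 1)))"
    if "lin H" for H :: "('a \<Rightarrow>\<^sub>0 complex) \<Rightarrow> ('b \<Rightarrow>\<^sub>0 complex)"
  proof -
    have "H f = H (lin_ext (\<lambda>u. single u 1) f)"
      by (simp only: lin_ext_singles)
    also have "\<dots> = (\<Sum>u\<in>keys f. smul (lookup f u) (H (single u 1)))"
      using that unfolding lin_ext_def by (simp only: lin_sum lin_smul)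
    finally show ?thesis .
  qed
  show ?thesis
    using assms by (simp add: *[of F] *[of G] cong: sum.cong)
qed

lemma lin_eqI:
  assumes "lin F" "lin G"
    and "\<And>u. F (single u 1) = G (single u 1)"
  shows "F f = G f"
  using assms by (rule lin_eq_on)

text \<open>\<open>tmul\<close> and \<open>tensor_cons\<close> put the left factor into the outer
  \<open>lin_ext\<close>; their linearity on the right is then linearity in a parameter of the
  images of the basis vectors.\<close>

lemma lin_lin_ext_param:
  assumes "\<And>u. lin (\<lambda>g. \<phi> g u)"
  shows "lin (\<lambda>g. lin_ext (\<phi> g) f)"
  by (rule linI)
     (simp_all add: lin_ext_def lin_add[OF assms] lin_smul[OF assms] sum.distrib
        lin_sum[OF lin_smul_fun] mult.commute)

lemma lin_ext_compose: "lin F \<Longrightarrow> F (lin_ext \<phi> f) = lin_ext (\<lambda>u. F (\<phi> u)) f"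
  by (simp add: lin_ext_def lin_sum lin_smul)

lemma keys_lin_ext: "keys (lin_ext \<phi> f) \<subseteq> (\<Union>u\<in>keys f. keys (\<phi> u))"
proof -
  have "keys (lin_ext \<phi> f)
      \<subseteq> (\<Union>u\<in>keys f. keys (smul (lookup f u) (\<phi> u)))"
    unfolding lin_ext_def by (rule Poly_Mapping.keys_sum)
  then show ?thesis by (fastforce simp: in_keys_iff)
qed

section \<open>Twisted monoid algebras\<close>

text \<open>The product of \<open>twisted_algebra\<close> freed from the ring record. In a tensor
  power it does not mention the number of factors, so one function serves words of every
  length.\<close>

definition tmul :: "('a \<Rightarrow> 'a \<Rightarrow> 'a) \<Rightarrow> ('a \<Rightarrow> 'a \<Rightarrow> complex)
    \<Rightarrow> ('a \<Rightarrow>\<^sub>0 complex) \<Rightarrow> ('a \<Rightarrow>\<^sub>0 complex) \<Rightarrow> ('a \<Rightarrow>\<^sub>0 complex)" where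
  "tmul m \<sigma> f g = lin_ext (\<lambda>u. lin_ext (\<lambda>v. single (m u v) (\<sigma> u v)) g) f"

lemma lin_tmul_left: "lin (\<lambda>f. tmul m \<sigma> f g)"
  by (simp add: tmul_def)

lemma lin_tmul_right: "lin (tmul m \<sigma> f)"
  unfolding tmul_def by (rule lin_lin_ext_param) simp

lemma tmul_single:
  "tmul m \<sigma> (single u c) (single v d)
     = single (m u v) (\<sigma> u v * c * d)"
  by (simp add: tmul_def mult.commute mult.left_commute)

lemma mult_twisted_algebra: "monoid.mult (twisted_algebra G \<sigma>) = tmul (monoid.mult G) \<sigma>"
  by (intro ext)
     (simp add: twisted_algebra_def tmul_def lin_ext_def lin_sum[OF lin_smul_fun] mult_ac)

lemma twisted_algebra_simps:
  "carrier (twisted_algebra G \<sigma>) = {f. keys f \<subseteq> carrier G}"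
  "\<one>\<^bsub>twisted_algebra G \<sigma>\<^esub> = single \<one>\<^bsub>G\<^esub> 1"
  "\<zero>\<^bsub>twisted_algebra G \<sigma>\<^esub> = 0"
  "f \<oplus>\<^bsub>twisted_algebra G \<sigma>\<^esub> g = f + g"
  by (simp_all add: twisted_algebra_def)

lemma keys_tmul:
  "keys (tmul m \<sigma> f g)
     \<subseteq> (\<Union>u\<in>keys f. \<Union>v\<in>keys g. {m u v})"
proof -
  have "keys (tmul m \<sigma> f g)
      \<subseteq> (\<Union>u\<in>keys f. keys (lin_ext (\<lambda>v. single (m u v) (\<sigma> u v)) g))"
    unfolding tmul_def by (rule keys_lin_ext)
  also have "\<dots> \<subseteq> (\<Union>u\<in>keys f. \<Union>v\<in>keys g. keys (single (m u v) (\<sigma> u v)))"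
    by (intro UN_mono keys_lin_ext order_refl)
  also have "\<dots> \<subseteq> (\<Union>u\<in>keys f. \<Union>v\<in>keys g. {m u v})"
    by (intro UN_mono order_refl) simp
  finally show ?thesis .
qed

text \<open>The 2-cocycle condition on \<sigma> is associativity tested on three basis vectors;
  trilinearity does the rest.\<close>

lemma ring_twisted_algebra:
  fixes G (structure)
  assumes "monoid G"
    and cocycle: "\<And>u v w. \<lbrakk>u \<in> carrier G; v \<in> carrier G; w \<in> carrier G\<rbrakk>
      \<Longrightarrow> \<sigma> u v * \<sigma> (u \<otimes> v) w = \<sigma> v w * \<sigma> u (v \<otimes> w)"
    and unit: "\<And>u. u \<in> carrier G \<Longrightarrow> \<sigma> \<one> u = 1" "\<And>u. u \<in> carrier G \<Longrightarrow> \<sigma> u \<one> = 1"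
  shows "ring (twisted_algebra G \<sigma>)"
proof -
  interpret monoid G by fact
  let ?m = "tmul (\<otimes>) \<sigma>"
  have assoc: "?m (?m f g) h = ?m f (?m g h)"
    if "keys f \<subseteq> carrier G" "keys g \<subseteq> carrier G"
      "keys h \<subseteq> carrier G" for f g h
  proof (rule lin_eq_on[of "\<lambda>f. ?m (?m f g) h"])
    show "lin (\<lambda>f. ?m (?m f g) h)"
      by (rule lin_compose[OF lin_tmul_left lin_tmul_left])
    show "lin (\<lambda>f. ?m f (?m g h))" by (rule lin_tmul_left)
    fix u assume u: "u \<in> keys f"
    show "?m (?m (single u 1) g) h = ?m (single u 1) (?m g h)"
    proof (rule lin_eq_on[of "\<lambda>g. ?m (?m (single u 1) g) h"])
      show "lin (\<lambda>g. ?m (?m (single u 1) g) h)"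
        by (rule lin_compose[OF lin_tmul_left lin_tmul_right])
      show "lin (\<lambda>g. ?m (single u 1) (?m g h))"
        by (rule lin_compose[OF lin_tmul_right lin_tmul_left])
      fix v assume v: "v \<in> keys g"
      show "?m (?m (single u 1) (single v 1)) h
          = ?m (single u 1) (?m (single v 1) h)"
      proof (rule lin_eq_on[of "?m (?m (single u 1) (single v 1))"])
        show "lin (\<lambda>h. ?m (single u 1) (?m (single v 1) h))"
          by (rule lin_compose[OF lin_tmul_right lin_tmul_right])
        fix w assume w: "w \<in> keys h"
        have "u \<in> carrier G" "v \<in> carrier G" "w \<in> carrier G"
          using u v w that by auto
        then show "?m (?m (single u 1) (single v 1)) (single w 1)
          = ?m (single u 1) (?m (single v 1) (single w 1))"
          using cocycle[of u v w] by (simp add: tmul_single m_assoc mult.commute)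
      qed (rule lin_tmul_right)
    qed
  qed
  have one_l: "?m (single \<one> 1) f = f" if "keys f \<subseteq> carrier G" for f
    by (rule lin_eq_on[OF lin_tmul_right lin_id]) (use that in \<open>auto simp: tmul_single unit\<close>)
  have one_r: "?m f (single \<one> 1) = f" if "keys f \<subseteq> carrier G" for f
    by (rule lin_eq_on[OF lin_tmul_left lin_id]) (use that in \<open>auto simp: tmul_single unit\<close>)
  show ?thesis
  proof (rule ringI)
    show "abelian_group (twisted_algebra G \<sigma>)"
    proof (rule abelian_groupI)
      fix f assume "f \<in> carrier (twisted_algebra G \<sigma>)"
      then show "\<exists>g\<in>carrier (twisted_algebra G \<sigma>). g \<oplus>\<^bsub>twisted_algebra G \<sigma>\<^esub> f = \<zero>\<^bsub>twisted_algebra G \<sigma>\<^esub>"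
        by (intro bexI[of _ "- f"]) (auto simp: twisted_algebra_simps)
    next
      fix f g
      assume "f \<in> carrier (twisted_algebra G \<sigma>)" "g \<in> carrier (twisted_algebra G \<sigma>)"
      then show "f \<oplus>\<^bsub>twisted_algebra G \<sigma>\<^esub> g \<in> carrier (twisted_algebra G \<sigma>)"
        using Poly_Mapping.keys_add[of f g] by (auto simp: twisted_algebra_simps)
    qed (simp_all add: twisted_algebra_simps add_ac)
    show "monoid (twisted_algebra G \<sigma>)"
    proof (rule monoidI)
      fix f g assume "f \<in> carrier (twisted_algebra G \<sigma>)" "g \<in> carrier (twisted_algebra G \<sigma>)"
      then show "f \<otimes>\<^bsub>twisted_algebra G \<sigma>\<^esub> g \<in> carrier (twisted_algebra G \<sigma>)"
        using keys_tmul[of "(\<otimes>)" \<sigma> f g]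
        by (simp add: twisted_algebra_simps mult_twisted_algebra) blast
    qed (auto simp: twisted_algebra_simps mult_twisted_algebra assoc one_l one_r)
  qed (simp_all add: twisted_algebra_simps mult_twisted_algebra
        lin_add[OF lin_tmul_left] lin_add[OF lin_tmul_right])
qed

section \<open>Tensor powers\<close>

text \<open>The twist of a tensor power is a product of twists, one for each factor, so the cocycle
  identities of the factors multiply.\<close>

lemma prod_list_cocycle:
  assumes "length us = length vs" "length vs = length ws"
    and "set us \<subseteq> A" "set vs \<subseteq> A" "set ws \<subseteq> A"
    and "\<And>u v w. \<lbrakk>u \<in> A; v \<in> A; w \<in> A\<rbrakk>
      \<Longrightarrow> \<sigma> u v * \<sigma> (m u v) w = \<sigma> v w * \<sigma> u (m v w)"
  shows "prod_list (map2 \<sigma> us vs) * prod_list (map2 \<sigma> (map2 m us vs) ws)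
       = prod_list (map2 \<sigma> vs ws) * (prod_list (map2 \<sigma> us (map2 m vs ws)) :: complex)"
  using assms(1-5)
proof (induction us vs ws rule: list_induct3)
  case (Cons u us v vs w ws)
  have *: "a * p * (b * r) = c * s * (d * t)" if "a * b = c * d" "p * r = s * t"
    for a b c d p r s t :: complex
    using arg_cong2[OF that, of "(*)"] by (simp add: mult_ac)
  show ?case
    using Cons assms(6)[of u v w] by simp (rule *; assumption)
qed simp

lemma monoid_power_monoid:
  assumes "monoid G"
  shows "monoid (power_monoid m G)"
proof -
  interpret monoid G by fact
  have assoc: "map2 (monoid.mult G) (map2 (monoid.mult G) us vs) ws
      = map2 (monoid.mult G) us (map2 (monoid.mult G) vs ws)"
    if "length us = length vs" "length vs = length ws"
      "set us \<subseteq> carrier G" "set vs \<subseteq> carrier G" "set ws \<subseteq> carrier G" for us vs ws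
    using that by (induction us vs ws rule: list_induct3) (auto simp: m_assoc)
  have closed: "set (map2 (monoid.mult G) us vs) \<subseteq> carrier G"
    if "set us \<subseteq> carrier G" "set vs \<subseteq> carrier G" for us vs
    using that by (induction us vs rule: list_induct2') auto
  have one_l: "map2 (monoid.mult G) (replicate (length us) \<one>\<^bsub>G\<^esub>) us = us"
    and one_r: "map2 (monoid.mult G) us (replicate (length us) \<one>\<^bsub>G\<^esub>) = us"
    if "set us \<subseteq> carrier G" for us
    using that by (induction us) auto
  show ?thesis
    by (rule monoidI) (use closed assoc one_l one_r in \<open>auto simp: power_monoid_def simp del: set_map\<close>)
qed

lemma ring_tensor_power:
  fixes G (structure)
  assumes "monoid G"
    and cocycle: "\<And>u v w. \<lbrakk>u \<in> carrier G; v \<in> carrier G; w \<in> carrier G\<rbrakk>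
      \<Longrightarrow> \<sigma> u v * \<sigma> (u \<otimes> v) w = \<sigma> v w * \<sigma> u (v \<otimes> w)"
    and unit: "\<And>u. u \<in> carrier G \<Longrightarrow> \<sigma> \<one> u = 1" "\<And>u. u \<in> carrier G \<Longrightarrow> \<sigma> u \<one> = 1"
  shows "ring (tensor_power m G \<sigma>)"
  unfolding tensor_power_def
proof (rule ring_twisted_algebra)
  show "monoid (power_monoid m G)" by (rule monoid_power_monoid) fact
  fix us assume "us \<in> carrier (power_monoid m G)"
  then have us: "length us = m" "set us \<subseteq> carrier G" by (auto simp: power_monoid_def)
  have "prod_list (map2 \<sigma> (replicate (length us) \<one>) us) = 1"
       "prod_list (map2 \<sigma> us (replicate (length us) \<one>)) = 1"
    using us(2) by (induction us) (auto simp: unit)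
  then show "prod_list (map2 \<sigma> \<one>\<^bsub>power_monoid m G\<^esub> us) = 1"
       "prod_list (map2 \<sigma> us \<one>\<^bsub>power_monoid m G\<^esub>) = 1"
    using us(1) by (simp_all add: power_monoid_def)
next
  fix us vs ws
  assume "us \<in> carrier (power_monoid m G)" "vs \<in> carrier (power_monoid m G)"
    "ws \<in> carrier (power_monoid m G)"
  then show "prod_list (map2 \<sigma> us vs) * prod_list (map2 \<sigma> (us \<otimes>\<^bsub>power_monoid m G\<^esub> vs) ws)
    = prod_list (map2 \<sigma> vs ws) * prod_list (map2 \<sigma> us (vs \<otimes>\<^bsub>power_monoid m G\<^esub> ws))"
    using cocycle
    by (simp add: power_monoid_def) (rule prod_list_cocycle[where A = "carrier G"]; simp)
qed

abbreviation list_tmul :: "('a \<Rightarrow> 'a \<Rightarrow> 'a) \<Rightarrow> ('a \<Rightarrow> 'a \<Rightarrow> complex)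
    \<Rightarrow> ('a list \<Rightarrow>\<^sub>0 complex) \<Rightarrow> ('a list \<Rightarrow>\<^sub>0 complex) \<Rightarrow> ('a list \<Rightarrow>\<^sub>0 complex)" where
  "list_tmul m \<sigma> \<equiv> tmul (map2 m) (\<lambda>us vs. prod_list (map2 \<sigma> us vs))"

lemma mult_tensor_power: "monoid.mult (tensor_power m G \<sigma>) = list_tmul (monoid.mult G) \<sigma>"
  by (simp add: tensor_power_def mult_twisted_algebra power_monoid_def)

lemma tensor_power_simps:
  "carrier (tensor_power m G \<sigma>) = {f. \<forall>us\<in>keys f. length us = m \<and> set us \<subseteq> carrier G}"
  "\<one>\<^bsub>tensor_power m G \<sigma>\<^esub> = single (replicate m \<one>\<^bsub>G\<^esub>) 1"
  "\<zero>\<^bsub>tensor_power m G \<sigma>\<^esub> = 0"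
  "f \<oplus>\<^bsub>tensor_power m G \<sigma>\<^esub> g = f + g"
  by (auto simp: tensor_power_def twisted_algebra_simps power_monoid_def)

lemma tensor_cons_alt:
  "tensor_cons f g = lin_ext (\<lambda>u. lin_ext (\<lambda>us. single (u # us) 1) g) f"
  by (simp add: tensor_cons_def lin_ext_def lin_sum[OF lin_smul_fun])

lemma lin_tensor_cons_left: "lin (\<lambda>f. tensor_cons f g)"
  by (simp add: tensor_cons_alt)

lemma lin_tensor_cons_right: "lin (tensor_cons f)"
  unfolding tensor_cons_alt by (rule lin_lin_ext_param) simp

lemma tensor_cons_single [simp]:
  "tensor_cons (single u c) (single us d) = single (u # us) (c * d)"
  by (simp add: tensor_cons_alt)

lemma keys_tensor_cons:
  "keys (tensor_cons f g) \<subseteq> (\<Union>u\<in>keys f. \<Union>us\<in>keys g. {u # us})"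
proof -
  have "keys (tensor_cons f g) \<subseteq> (\<Union>u\<in>keys f. keys (lin_ext (\<lambda>us. single (u # us) 1) g))"
    unfolding tensor_cons_alt by (rule keys_lin_ext)
  also have "\<dots> \<subseteq> (\<Union>u\<in>keys f. \<Union>us\<in>keys g. keys (single (u # us) (1 :: complex)))"
    by (intro UN_mono keys_lin_ext order_refl)
  finally show ?thesis by simp
qed

text \<open>Different tensor factors commute without a scalar, so the first factor splits off from a
  product. The inductions on the word rest on this.\<close>

lemma tensor_cons_mult:
  "list_tmul m \<sigma> (tensor_cons f g) (tensor_cons f' g') = tensor_cons (tmul m \<sigma> f f') (list_tmul m \<sigma> g g')"
proof (rule lin_eqI[where f = f])
  show "lin (\<lambda>f. list_tmul m \<sigma> (tensor_cons f g) (tensor_cons f' g'))"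
    by (rule lin_compose[OF lin_tmul_left lin_tensor_cons_left])
  show "lin (\<lambda>f. tensor_cons (tmul m \<sigma> f f') (list_tmul m \<sigma> g g'))"
    by (rule lin_compose[OF lin_tensor_cons_left lin_tmul_left])
  fix u
  show "list_tmul m \<sigma> (tensor_cons (single u 1) g) (tensor_cons f' g')
      = tensor_cons (tmul m \<sigma> (single u 1) f') (list_tmul m \<sigma> g g')"
  proof (rule lin_eqI[where f = f'])
    show "lin (\<lambda>f'. list_tmul m \<sigma> (tensor_cons (single u 1) g) (tensor_cons f' g'))"
      by (rule lin_compose[OF lin_tmul_right lin_tensor_cons_left])
    show "lin (\<lambda>f'. tensor_cons (tmul m \<sigma> (single u 1) f') (list_tmul m \<sigma> g g'))"
      by (rule lin_compose[OF lin_tensor_cons_left lin_tmul_right])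
    fix v
    show "list_tmul m \<sigma> (tensor_cons (single u 1) g) (tensor_cons (single v 1) g')
      = tensor_cons (tmul m \<sigma> (single u 1) (single v 1)) (list_tmul m \<sigma> g g')"
    proof (rule lin_eqI[where f = g])
      show "lin (\<lambda>g. list_tmul m \<sigma> (tensor_cons (single u 1) g) (tensor_cons (single v 1) g'))"
        by (rule lin_compose[OF lin_tmul_left lin_tensor_cons_right])
      show "lin (\<lambda>g. tensor_cons (tmul m \<sigma> (single u 1) (single v 1)) (list_tmul m \<sigma> g g'))"
        by (rule lin_compose[OF lin_tensor_cons_right lin_tmul_left])
      fix us
      show "list_tmul m \<sigma> (tensor_cons (single u 1) (single us 1)) (tensor_cons (single v 1) g')
        = tensor_cons (tmul m \<sigma> (single u 1) (single v 1)) (list_tmul m \<sigma> (single us 1) g')"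
      proof (rule lin_eqI[where f = g'])
        show "lin (\<lambda>g'. list_tmul m \<sigma> (tensor_cons (single u 1) (single us 1)) (tensor_cons (single v 1) g'))"
          by (rule lin_compose[OF lin_tmul_right lin_tensor_cons_right])
        show "lin (\<lambda>g'. tensor_cons (tmul m \<sigma> (single u 1) (single v 1)) (list_tmul m \<sigma> (single us 1) g'))"
          by (rule lin_compose[OF lin_tensor_cons_right lin_tmul_right])
      qed (simp add: tmul_single)
    qed
  qed
qed

section \<open>Homomorphisms from the free algebra\<close>

lemma mult_free_alg: "monoid.mult free_alg = tmul (@) (\<lambda>_ _. 1)"
  by (simp add: free_alg_def mult_twisted_algebra words_def)

lemma free_alg_simps:
  "carrier free_alg = {f. keys f \<subseteq> lists ({1..3} \<times> {1..3})}"
  "\<one>\<^bsub>free_alg\<^esub> = single [] 1"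
  "\<zero>\<^bsub>free_alg\<^esub> = 0"
  "f \<oplus>\<^bsub>free_alg\<^esub> g = f + g"
  by (simp_all add: free_alg_def twisted_algebra_simps words_def)

lemma monoid_words: "monoid words"
  by (rule monoidI) (auto simp: words_def)

lemma ring_free_alg: "ring free_alg"
  unfolding free_alg_def by (rule ring_twisted_algebra[OF monoid_words]) simp_all

lemma lin_hom_ext: "lin (hom_ext A \<phi>)"
  by (simp add: hom_ext_def)

lemma hom_ext_single:
  "hom_ext A \<phi> (single w c) = smul c (foldr (monoid.mult A) (map \<phi> w) \<one>\<^bsub>A\<^esub>)"
  by (simp add: hom_ext_def)

lemma foldr_mult_closed:
  assumes "monoid A" "set xs \<subseteq> carrier A"
  shows "foldr (monoid.mult A) xs \<one>\<^bsub>A\<^esub> \<in> carrier A"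
  using assms(2) by (induction xs) (auto intro: monoid.m_closed monoid.one_closed assms(1))

lemma foldr_mult_append:
  assumes "monoid A" "set xs \<subseteq> carrier A" "set ys \<subseteq> carrier A"
  shows "foldr (monoid.mult A) (xs @ ys) \<one>\<^bsub>A\<^esub>
    = foldr (monoid.mult A) xs \<one>\<^bsub>A\<^esub> \<otimes>\<^bsub>A\<^esub> foldr (monoid.mult A) ys \<one>\<^bsub>A\<^esub>"
  using assms(2)
proof (induction xs)
  case Nil
  then show ?case using foldr_mult_closed[OF assms(1,3)] assms(1) by (simp add: monoid.l_one)
next
  case (Cons x xs)
  then show ?case
    using foldr_mult_closed[OF assms(1,3)] foldr_mult_closed[OF assms(1), of xs]
    by (simp add: monoid.m_assoc[OF assms(1)])
qed

text \<open>Concatenation turns into the product by associativity, which needs the values of \<phi>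
  to lie in the carrier. Generators with indices outside \<open>{1..3}\<close> may occur in
  \<open>f\<close> and \<open>g\<close>, because \<phi> is closed on those as well.\<close>

lemma hom_ext_mult:
  assumes "A = twisted_algebra H \<tau>" "ring A" "\<And>x. \<phi> x \<in> carrier A"
  shows "hom_ext A \<phi> (f \<otimes>\<^bsub>free_alg\<^esub> g) = hom_ext A \<phi> f \<otimes>\<^bsub>A\<^esub> hom_ext A \<phi> g"
proof -
  have A: "monoid.mult A = tmul (monoid.mult H) \<tau>" by (simp add: assms(1) mult_twisted_algebra)
  have mon: "monoid A" using assms(2) by (rule ring.is_monoid)
  show ?thesis
  proof (rule lin_eqI[where f = f])
    show "lin (\<lambda>f. hom_ext A \<phi> (f \<otimes>\<^bsub>free_alg\<^esub> g))"
      unfolding mult_free_alg by (rule lin_compose[OF lin_hom_ext lin_tmul_left])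
    show "lin (\<lambda>f. hom_ext A \<phi> f \<otimes>\<^bsub>A\<^esub> hom_ext A \<phi> g)"
      unfolding A by (rule lin_compose[OF lin_tmul_left lin_hom_ext])
    fix w
    show "hom_ext A \<phi> (single w 1 \<otimes>\<^bsub>free_alg\<^esub> g) = hom_ext A \<phi> (single w 1) \<otimes>\<^bsub>A\<^esub> hom_ext A \<phi> g"
    proof (rule lin_eqI[where f = g])
      show "lin (\<lambda>g. hom_ext A \<phi> (single w 1 \<otimes>\<^bsub>free_alg\<^esub> g))"
        unfolding mult_free_alg by (rule lin_compose[OF lin_hom_ext lin_tmul_right])
      show "lin (\<lambda>g. hom_ext A \<phi> (single w 1) \<otimes>\<^bsub>A\<^esub> hom_ext A \<phi> g)"
        unfolding A by (rule lin_compose[OF lin_tmul_right lin_hom_ext])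
      fix w'
      have "foldr (monoid.mult A) (map \<phi> w @ map \<phi> w') \<one>\<^bsub>A\<^esub>
        = foldr (monoid.mult A) (map \<phi> w) \<one>\<^bsub>A\<^esub> \<otimes>\<^bsub>A\<^esub> foldr (monoid.mult A) (map \<phi> w') \<one>\<^bsub>A\<^esub>"
        by (rule foldr_mult_append[OF mon]) (use assms(3) in auto)
      then show "hom_ext A \<phi> (single w 1 \<otimes>\<^bsub>free_alg\<^esub> single w' 1)
          = hom_ext A \<phi> (single w 1) \<otimes>\<^bsub>A\<^esub> hom_ext A \<phi> (single w' 1)"
        by (simp add: mult_free_alg tmul_single hom_ext_single)
    qed
  qed
qed

lemma hom_ext_closed:
  assumes "A = twisted_algebra H \<tau>" "ring A" "\<And>x. \<phi> x \<in> carrier A"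
  shows "hom_ext A \<phi> f \<in> carrier A"
proof -
  have "foldr (monoid.mult A) (map \<phi> w) \<one>\<^bsub>A\<^esub> \<in> carrier A" for w
    by (rule foldr_mult_closed[OF ring.is_monoid[OF assms(2)]]) (use assms(3) in auto)
  then show ?thesis
    using keys_lin_ext[of "\<lambda>w. foldr (monoid.mult A) (map \<phi> w) \<one>\<^bsub>A\<^esub>" f]
    unfolding hom_ext_def assms(1) twisted_algebra_simps by blast
qed

section \<open>The induced representation on words\<close>

lemma monoid_xy: "monoid xy_monoid"
  by (rule monoidI) (auto simp: xy_monoid_def)

abbreviation xy_mult :: "int \<times> int \<Rightarrow> int \<times> int \<Rightarrow> int \<times> int" where
  "xy_mult \<equiv> \<lambda>(a, b) (c, d). (a + c, b + d)"

lemma xy_monoid_simps [simp]: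
  "monoid.mult xy_monoid = xy_mult" "carrier xy_monoid = UNIV" "\<one>\<^bsub>xy_monoid\<^esub> = (0, 0)"
  by (simp_all add: xy_monoid_def)

lemma xy_twist_cocycle:
  assumes "q \<noteq> 0"
  shows "xy_twist q u v * xy_twist q (xy_mult u v) w = xy_twist q v w * xy_twist q u (xy_mult v w)"
  using assms
  by (cases u; cases v; cases w)
     (simp add: xy_twist_def power_int_add [symmetric] algebra_simps)

lemma xy_twist_unit: "xy_twist q (0, 0) u = 1" "xy_twist q u (0, 0) = 1"
  by (cases u; simp add: xy_twist_def)+

lemma ring_Lq:
  assumes "q \<noteq> 0"
  shows "ring (Lq q m)"
  unfolding Lq_def
  by (rule ring_tensor_power[OF monoid_xy])
     (use xy_twist_cocycle[OF assms] in \<open>simp_all add: xy_twist_unit\<close>)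

abbreviation lmul where "lmul q \<equiv> list_tmul xy_mult (xy_twist q)"

lemma Lq_simps:
  "monoid.mult (Lq q m) = lmul q"
  "carrier (Lq q m) = {f. \<forall>us\<in>keys f. length us = m}"
  "\<one>\<^bsub>Lq q m\<^esub> = single (replicate m (0, 0)) 1"
  "\<zero>\<^bsub>Lq q m\<^esub> = 0"
  "f \<oplus>\<^bsub>Lq q m\<^esub> g = f + g"
  unfolding Lq_def mult_tensor_power by (simp_all add: tensor_power_simps)

lemma Lq_twisted_algebra:
  "Lq q m = twisted_algebra (power_monoid m xy_monoid) (\<lambda>us vs. prod_list (map2 (xy_twist q) us vs))"
  by (simp add: Lq_def tensor_power_def)

lemma Lq2_simps:
  "monoid.mult (Lq2 q) = tmul xy_mult (xy_twist q)"
  "\<one>\<^bsub>Lq2 q\<^esub> = single (0, 0) 1"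
  "carrier (Lq2 q) = UNIV"
  by (simp_all add: Lq2_def mult_twisted_algebra twisted_algebra_simps)

text \<open>Recursion on the head of the word makes a new letter multiply from the left, that is,
  act on rows. The invariants of the matrix are proved along this recursion.\<close>

fun T_mat :: "int list \<Rightarrow> gen \<Rightarrow> ((int \<times> int) list \<Rightarrow>\<^sub>0 complex)" where
  "T_mat [] (i, j) = (if i = j then single [] 1 else 0)"
| "T_mat (s # is) (i, j) = (\<Sum>k\<in>{1..3}. tensor_cons (psi_gen s (i, k)) (T_mat is (k, j)))"

lemma T_mat_closed: "T_mat is x \<in> carrier (Lq q (length is))"
proof (induction "is" x rule: T_mat.induct)
  case (2 s "is" i j)
  have "keys (T_mat (s # is) (i, j))
      \<subseteq> (\<Union>k\<in>{1..3}. keys (tensor_cons (psi_gen s (i, k)) (T_mat is (k, j))))"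
    unfolding T_mat.simps by (rule Poly_Mapping.keys_sum)
  also have "\<dots> \<subseteq> (\<Union>k\<in>{1..3}. \<Union>u\<in>keys (psi_gen s (i, k)). \<Union>us\<in>keys (T_mat is (k, j)). {u # us})"
    by (intro UN_mono keys_tensor_cons order_refl)
  finally have sub: "keys (T_mat (s # is) (i, j))
      \<subseteq> (\<Union>k\<in>{1..3}. \<Union>u\<in>keys (psi_gen s (i, k)). \<Union>us\<in>keys (T_mat is (k, j)). {u # us})" .
  have "length us = length is" if "k \<in> {1..3}" "us \<in> keys (T_mat is (k, j))" for k us
    using 2[OF that(1)] that(2) by (simp add: Lq_simps)
  with sub show ?case unfolding Lq_simps by (auto simp del: T_mat.simps)
qed (simp add: Lq_simps)

lemma lin_iter_coproduct: "lin (iter_coproduct m)"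
proof (cases m)
  case 0
  then show ?thesis using lin_hom_ext by (simp add: counit_def fun_eq_iff lin_def)
next
  case (Suc n)
  have "lin (\<lambda>f. lin_ext \<phi> (coproduct f))" for \<phi> :: "_ \<Rightarrow> gen list list \<Rightarrow>\<^sub>0 complex"
    unfolding coproduct_def by (rule lin_compose[OF lin_lin_ext lin_hom_ext])
  then show ?thesis by (simp add: Suc lin_def)
qed

lemma lin_pi_free: "lin (pi_free q is)"
  unfolding pi_free_def psi_tensor_def o_def by (rule lin_compose[OF lin_lin_ext lin_iter_coproduct])

text \<open>The maps \<open>psi\<close> act factor by factor, so the recursion that defines the
  iterated coproduct passes to the composite.\<close>

lemma pi_free_Cons:
  "pi_free q (s # is) f =
     lin_ext (\<lambda>us. tensor_cons (psi q s (single (us ! 0) 1)) (pi_free q is (single (us ! 1) 1)))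
       (coproduct f)"
proof -
  have *: "psi_tensor q (s # is) (tensor_cons (single u 1) g)
      = tensor_cons (psi q s (single u 1)) (psi_tensor q is g)" for u g
  proof (rule lin_eqI[where f = g])
    show "lin (\<lambda>g. psi_tensor q (s # is) (tensor_cons (single u 1) g))"
      unfolding psi_tensor_def by (rule lin_compose[OF lin_lin_ext lin_tensor_cons_right])
    show "lin (\<lambda>g. tensor_cons (psi q s (single u 1)) (psi_tensor q is g))"
      unfolding psi_tensor_def by (rule lin_compose[OF lin_tensor_cons_right lin_lin_ext])
  qed (simp add: psi_tensor_def tensor_def)
  have "lin (psi_tensor q (s # is))" by (simp add: psi_tensor_def)
  then show ?thesis
    by (simp add: pi_free_def lin_ext_compose[of "psi_tensor q (s # is)"] * )
qed

lemma foldr_delta: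
  "foldr (list_tmul m \<sigma>) (map (\<lambda>(i, j). if i = j then single [] 1 else 0) w) (single [] 1)
     = (if \<forall>p\<in>set w. fst p = snd p then single [] 1 else 0)"
  by (induction w) (auto simp: tmul_single lin_0[OF lin_tmul_left] lin_0[OF lin_tmul_right])

text \<open>The coproduct and the maps \<open>psi\<close> are multiplicative, hence so is their
  composite, and the values on generators determine it. These values multiply like matrices because
  the coproduct of a generator has the shape of a matrix product.\<close>

lemma pi_free_eq:
  assumes "q \<noteq> 0"
  shows "pi_free q is f = hom_ext (Lq q (length is)) (T_mat is) f"
proof (induction "is" arbitrary: f)
  case Nil
  show ?case
  proof (rule lin_eqI[OF lin_pi_free lin_hom_ext])
    fix w
    have T: "T_mat [] = (\<lambda>(i, j). if i = j then single [] 1 else 0)" by auto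
    show "pi_free q [] (single w 1) = hom_ext (Lq q (length [])) (T_mat []) (single w 1)"
      by (simp add: pi_free_def psi_tensor_def counit_def hom_ext_single mult_tensor_power
          tensor_power_simps foldr_delta Lq_simps T tensor_def lin_0)
  qed
next
  case (Cons s "is")
  let ?A = "tensor_power 2 words (\<lambda>_ _. 1)"
  let ?\<phi> = "\<lambda>(i, j). \<Sum>k\<in>{1..3}. tensor [X i k, X k j]"
  let ?\<Phi> = "lin_ext (\<lambda>us. tensor_cons (psi q s (single (us ! 0) 1)) (pi_free q is (single (us ! 1) 1)))"
  let ?n = "length is"
  let ?cop = "\<lambda>w. foldr (monoid.mult ?A) (map ?\<phi> w) \<one>\<^bsub>?A\<^esub>"
  have X: "tensor [X i k, X k j] = single [[(i, k)], [(k, j)]] 1" for i k j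
    by (simp add: tensor_def X_def)
  have mult: "monoid.mult ?A = list_tmul (@) (\<lambda>_ _. 1)"
    by (simp add: mult_tensor_power words_def)
  have len: "\<forall>us\<in>keys (?cop w). length us = 2" for w
  proof (induction w)
    case (Cons p w)
    have "keys (?\<phi> p) \<subseteq> {us. length us = 2}"
      using Poly_Mapping.keys_sum[of "\<lambda>k. single [[(fst p, k)], [(k, snd p)]] (1::complex)" "{1..3}"]
      by (fastforce simp: X split: prod.splits)
    then show ?case
      using Cons keys_tmul[of "map2 (@)" "\<lambda>us vs. prod_list (map2 (\<lambda>_ _. 1) us vs)" "?\<phi> p" "?cop w"]
      by (fastforce simp: mult)
  qed (simp add: tensor_power_simps)
  \<comment> \<open>\<open>foldr\<close> builds a word from the right; it suffices to know how left
    multiplication by one generator passes through \<open>?\<Phi>\<close>.\<close>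
  have step: "?\<Phi> (?\<phi> p \<otimes>\<^bsub>?A\<^esub> g) = lmul q (T_mat (s # is) p) (?\<Phi> g)"
    if "\<forall>us\<in>keys g. length us = 2" for p g
  proof (rule lin_eq_on[where f = g])
    show "lin (\<lambda>g. ?\<Phi> (?\<phi> p \<otimes>\<^bsub>?A\<^esub> g))"
      unfolding mult by (rule lin_compose[OF lin_lin_ext lin_tmul_right])
    show "lin (\<lambda>g. lmul q (T_mat (s # is) p) (?\<Phi> g))"
      by (rule lin_compose[OF lin_tmul_right lin_lin_ext])
    fix us assume "us \<in> keys g"
    with that have "length us = 2" by auto
    then obtain v w where us: "us = [v, w]"
      by (auto simp: length_Suc_conv numeral_2_eq_2)
    obtain i j where p: "p = (i, j)" by (cases p)
    have "?\<phi> p \<otimes>\<^bsub>?A\<^esub> single us 1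
        = (\<Sum>k\<in>{1..3}. single [(i, k) # v, (k, j) # w] 1)"
      unfolding mult p prod.case X us
      by (simp add: lin_sum[OF lin_tmul_left] tmul_single)
    then have "?\<Phi> (?\<phi> p \<otimes>\<^bsub>?A\<^esub> single us 1)
        = (\<Sum>k\<in>{1..3}. tensor_cons (psi q s (single ((i, k) # v) 1)) (pi_free q is (single ((k, j) # w) 1)))"
      by (simp only: lin_sum[OF lin_lin_ext] lin_ext_single) simp
    also have "\<dots> = (\<Sum>k\<in>{1..3}. lmul q (tensor_cons (psi_gen s (i, k)) (T_mat is (k, j)))
        (tensor_cons (psi q s (single v 1)) (pi_free q is (single w 1))))"
      by (simp add: Cons.IH psi_def hom_ext_single tensor_cons_mult Lq_simps Lq2_simps)
    also have "\<dots> = lmul q (T_mat (s # is) p) (?\<Phi> (single us 1))"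
      by (simp add: p us lin_sum[OF lin_tmul_left])
    finally show "?\<Phi> (?\<phi> p \<otimes>\<^bsub>?A\<^esub> single us 1) = lmul q (T_mat (s # is) p) (?\<Phi> (single us 1))" .
  qed
  show ?case
  proof (rule lin_eqI[OF lin_pi_free lin_hom_ext])
    fix w
    have "?\<Phi> (?cop w) = foldr (lmul q) (map (T_mat (s # is)) w) (single (replicate (Suc ?n) (0, 0)) 1)"
    proof (induction w)
      case Nil
      show ?case
        by (simp add: tensor_power_simps words_def psi_def Cons.IH hom_ext_single Lq_simps Lq2_simps
            numeral_2_eq_2)
    next
      case (Cons p w)
      then show ?case using step[OF len, of p w] by simp
    qed
    then show "pi_free q (s # is) (single w 1)
        = hom_ext (Lq q (length (s # is))) (T_mat (s # is)) (single w 1)"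
      by (simp add: pi_free_Cons coproduct_def hom_ext_single Lq_simps)
  qed
qed

section \<open>Quantum matrices\<close>

abbreviation consl :: "int \<times> int \<Rightarrow> ((int \<times> int) list \<Rightarrow>\<^sub>0 complex) \<Rightarrow> ((int \<times> int) list \<Rightarrow>\<^sub>0 complex)" where
  "consl p \<equiv> tensor_cons (single p 1)"

lemma consl_mult:
  "lmul q (consl (a, b) f) (consl (c, d) g) = smul (q powi - (b * c)) (consl (a + c, b + d) (lmul q f g))"
proof -
  have "lmul q (consl (a, b) f) (consl (c, d) g)
      = tensor_cons (smul (q powi - (b * c)) (single (a + c, b + d) 1)) (lmul q f g)"
    by (simp add: tensor_cons_mult tmul_single xy_twist_def)
  then show ?thesis by (simp only: lin_smul[OF lin_tensor_cons_left])
qed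

lemmas multilinear =
  lin_add[OF lin_tmul_left] lin_add[OF lin_tmul_right]
  lin_diff[OF lin_tmul_left] lin_diff[OF lin_tmul_right]
  lin_smul[OF lin_tmul_left] lin_smul[OF lin_tmul_right]
  lin_0[OF lin_tmul_left] lin_0[OF lin_tmul_right]
  lin_add[OF lin_tensor_cons_right] lin_diff[OF lin_tensor_cons_right]
  lin_smul[OF lin_tensor_cons_right] lin_0[OF lin_tensor_cons_right]
  lin_0[OF lin_tensor_cons_left]

section \<open>Row operations and the quantum commutation relations\<close>

type_synonym row = "nat \<Rightarrow> ((int \<times> int) list \<Rightarrow>\<^sub>0 complex)"

text \<open>The relations are sorted by rows because a letter affects only two adjacent rows, the
  third being multiplied by 1.\<close>

definition qrow :: "complex \<Rightarrow> row \<Rightarrow> bool" where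
  "qrow q a \<longleftrightarrow> (\<forall>j\<in>{1..3}. \<forall>l\<in>{1..3}. j < l \<longrightarrow> lmul q (a j) (a l) = smul q (lmul q (a l) (a j)))"

definition qpair :: "complex \<Rightarrow> row \<Rightarrow> row \<Rightarrow> bool" where
  "qpair q a b \<longleftrightarrow>
     (\<forall>j\<in>{1..3}. lmul q (a j) (b j) = smul q (lmul q (b j) (a j))) \<and>
     (\<forall>j\<in>{1..3}. \<forall>l\<in>{1..3}. j < l \<longrightarrow> lmul q (a l) (b j) = lmul q (b j) (a l) \<and>
        lmul q (a j) (b l) - lmul q (b l) (a j) = smul (q - inverse q) (lmul q (a l) (b j)))"

text \<open>Here and in \<open>qpair_rewrite\<close> the relations are oriented towards a normal
  order: smaller column first inside a row, upper row first between rows. Both sides of a relation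
  then become combinations of the same products, and only an identity of coefficients
  remains.\<close>

lemma qrow_rewrite:
  assumes "qrow q a" "q \<noteq> 0" "j \<in> {1..3}" "l \<in> {1..3}" "j < l"
  shows "lmul q (a l) (a j) = smul (inverse q) (lmul q (a j) (a l))"
  using assms by (simp add: qrow_def)

lemma qpair_rewrite:
  assumes "qpair q a b" "q \<noteq> 0" "j \<in> {1..3}"
  shows "lmul q (b j) (a j) = smul (inverse q) (lmul q (a j) (b j))"
    and "l \<in> {1..3} \<Longrightarrow> j < l \<Longrightarrow> lmul q (b j) (a l) = lmul q (a l) (b j)"
    and "l \<in> {1..3} \<Longrightarrow> j < l \<Longrightarrow>
      lmul q (b l) (a j) = lmul q (a j) (b l) - smul (q - inverse q) (lmul q (a l) (b j))"
  using assms by (force simp: qpair_def algebra_simps)+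

lemma qrow_consl:
  assumes "qrow q a"
  shows "qrow q (\<lambda>j. consl p (a j))"
  using assms by (cases p) (simp add: qrow_def consl_mult multilinear mult.commute)

text \<open>The mixed terms decide. By \<open>x y = q y x\<close> the left side contributes
  \<open>x y (a_j b_l + q^-1 a_l b_j)\<close>. On the right \<open>a_l b_j\<close> gets the
  coefficient \<open>q (1 - q^-1 (q - q^-1)) = q^-1\<close>, so the correction term in the relation
  between the rows is exactly what makes the sides agree.\<close>

lemma qrow_upper:
  assumes "qrow q a" "qrow q b" "qpair q a b" "q \<noteq> 0"
  shows "qrow q (\<lambda>j. consl (1, 0) (a j) + consl (0, 1) (b j))"
  unfolding qrow_def
proof (intro ballI impI)
  fix j l :: nat assume jl: "j \<in> {1..3}" "l \<in> {1..3}" "j < l"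
  note rw = qrow_rewrite[OF assms(1,4) jl] qrow_rewrite[OF assms(2,4) jl]
    qpair_rewrite[OF assms(3,4), of j] qpair_rewrite[OF assms(3,4), of l]
  show "lmul q (consl (1, 0) (a j) + consl (0, 1) (b j)) (consl (1, 0) (a l) + consl (0, 1) (b l))
     = smul q (lmul q (consl (1, 0) (a l) + consl (0, 1) (b l)) (consl (1, 0) (a j) + consl (0, 1) (b j)))"
    using jl assms(4)
    by (simp add: multilinear consl_mult rw power_int_minus del: atLeastAtMost_iff)
       (rule poly_mapping_eqI, simp add: lookup_add lookup_minus field_simps)
qed

lemma qrow_lower:
  assumes "qrow q a" "qrow q b" "qpair q a b" "q \<noteq> 0"
  shows "qrow q (\<lambda>j. consl (0, 1) (a j) + consl (-1, 0) (b j))"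
  unfolding qrow_def
proof (intro ballI impI)
  fix j l :: nat assume jl: "j \<in> {1..3}" "l \<in> {1..3}" "j < l"
  note rw = qrow_rewrite[OF assms(1,4) jl] qrow_rewrite[OF assms(2,4) jl]
    qpair_rewrite[OF assms(3,4), of j] qpair_rewrite[OF assms(3,4), of l]
  show "lmul q (consl (0, 1) (a j) + consl (-1, 0) (b j)) (consl (0, 1) (a l) + consl (-1, 0) (b l))
     = smul q (lmul q (consl (0, 1) (a l) + consl (-1, 0) (b l)) (consl (0, 1) (a j) + consl (-1, 0) (b j)))"
    using jl assms(4)
    by (simp add: multilinear consl_mult rw power_int_minus del: atLeastAtMost_iff)
       (rule poly_mapping_eqI, simp add: lookup_add lookup_minus field_simps)
qed

text \<open>The terms with \<open>a\<close> reproduce the old relations, since \<open>x\<close> and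
  \<open>x^-1\<close> cancel. The terms with \<open>y\<close> involve \<open>b\<close> alone and
  match because \<open>y x^-1 = q x^-1 y\<close> and \<open>qrow q b\<close>.\<close>

lemma qpair_upper:
  assumes "qrow q b" "qpair q a b" "q \<noteq> 0"
  shows "qpair q (\<lambda>j. consl (1, 0) (a j) + consl (0, 1) (b j)) (\<lambda>j. consl (-1, 0) (b j))"
  unfolding qpair_def
proof (intro conjI ballI impI)
  fix j :: nat assume j: "j \<in> {1..3}"
  note rw = qpair_rewrite[OF assms(2,3) j]
  show "lmul q (consl (1, 0) (a j) + consl (0, 1) (b j)) (consl (-1, 0) (b j))
     = smul q (lmul q (consl (-1, 0) (b j)) (consl (1, 0) (a j) + consl (0, 1) (b j)))"
    using assms(3)
    by (simp add: multilinear consl_mult rw power_int_minus)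
  fix l :: nat assume l: "l \<in> {1..3}" "j < l"
  note rw = qrow_rewrite[OF assms(1,3) j l] qpair_rewrite[OF assms(2,3), of j] qpair_rewrite[OF assms(2,3), of l]
  show "lmul q (consl (1, 0) (a l) + consl (0, 1) (b l)) (consl (-1, 0) (b j))
     = lmul q (consl (-1, 0) (b j)) (consl (1, 0) (a l) + consl (0, 1) (b l))"
    using j l assms(3)
    by (simp add: multilinear consl_mult rw power_int_minus del: atLeastAtMost_iff)
  show "lmul q (consl (1, 0) (a j) + consl (0, 1) (b j)) (consl (-1, 0) (b l))
      - lmul q (consl (-1, 0) (b l)) (consl (1, 0) (a j) + consl (0, 1) (b j))
     = smul (q - inverse q) (lmul q (consl (1, 0) (a l) + consl (0, 1) (b l)) (consl (-1, 0) (b j)))"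
    using j l assms(3)
    by (simp add: multilinear consl_mult rw power_int_minus del: atLeastAtMost_iff)
       (rule poly_mapping_eqI, simp add: lookup_add lookup_minus field_simps)
qed

lemma qpair_lower:
  assumes "qrow q a" "qpair q a b" "q \<noteq> 0"
  shows "qpair q (\<lambda>j. consl (1, 0) (a j)) (\<lambda>j. consl (0, 1) (a j) + consl (-1, 0) (b j))"
  unfolding qpair_def
proof (intro conjI ballI impI)
  fix j :: nat assume j: "j \<in> {1..3}"
  note rw = qpair_rewrite[OF assms(2,3) j]
  show "lmul q (consl (1, 0) (a j)) (consl (0, 1) (a j) + consl (-1, 0) (b j))
     = smul q (lmul q (consl (0, 1) (a j) + consl (-1, 0) (b j)) (consl (1, 0) (a j)))"
    using assms(3)
    by (simp add: multilinear consl_mult rw power_int_minus)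
  fix l :: nat assume l: "l \<in> {1..3}" "j < l"
  note rw = qrow_rewrite[OF assms(1,3) j l] qpair_rewrite[OF assms(2,3), of j] qpair_rewrite[OF assms(2,3), of l]
  show "lmul q (consl (1, 0) (a l)) (consl (0, 1) (a j) + consl (-1, 0) (b j))
     = lmul q (consl (0, 1) (a j) + consl (-1, 0) (b j)) (consl (1, 0) (a l))"
    using j l assms(3)
    by (simp add: multilinear consl_mult rw power_int_minus del: atLeastAtMost_iff)
  show "lmul q (consl (1, 0) (a j)) (consl (0, 1) (a l) + consl (-1, 0) (b l))
      - lmul q (consl (0, 1) (a l) + consl (-1, 0) (b l)) (consl (1, 0) (a j))
     = smul (q - inverse q) (lmul q (consl (1, 0) (a l)) (consl (0, 1) (a j) + consl (-1, 0) (b j)))"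
    using j l assms(3)
    by (simp add: multilinear consl_mult rw power_int_minus del: atLeastAtMost_iff)
       (rule poly_mapping_eqI, simp add: lookup_add lookup_minus field_simps)
qed

lemma qpair_consl_left: "qpair q a c \<Longrightarrow> qpair q (\<lambda>j. consl p (a j)) (\<lambda>j. consl (0, 0) (c j))"
  and qpair_consl_right: "qpair q c a \<Longrightarrow> qpair q (\<lambda>j. consl (0, 0) (c j)) (\<lambda>j. consl p (a j))"
  by (cases p; simp add: qpair_def consl_mult lin_smul[OF lin_tensor_cons_right]
      flip: lin_diff[OF lin_tensor_cons_right])+

text \<open>The relations with a third row \<open>c\<close> are linear in the row, so they pass to
  the sums that a row operation creates.\<close>

lemma qpair_add_left: "qpair q a c \<Longrightarrow> qpair q b c \<Longrightarrow> qpair q (\<lambda>j. a j + b j) c"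
  and qpair_add_right: "qpair q c a \<Longrightarrow> qpair q c b \<Longrightarrow> qpair q c (\<lambda>j. a j + b j)"
  by (simp_all add: qpair_def multilinear add_diff_add)

section \<open>Quantum minors and the quantum determinant\<close>

definition minor :: "complex \<Rightarrow> row \<Rightarrow> row \<Rightarrow> nat \<Rightarrow> nat \<Rightarrow> ((int \<times> int) list \<Rightarrow>\<^sub>0 complex)" where
  "minor q a b j l = lmul q (a j) (b l) - smul q (lmul q (a l) (b j))"

text \<open>The diagonal contributes \<open>x x^-1 = 1\<close>, and the term with \<open>y\<close>
  is a multiple of \<open>b_j b_l - q b_l b_j\<close>, which vanishes by
  \<open>qrow q b\<close>.\<close>

lemma minor_upper:
  assumes "qrow q b" "q \<noteq> 0" "j \<in> {1..3}" "l \<in> {1..3}" "j < l"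
  shows "minor q (\<lambda>j. consl (1, 0) (a j) + consl (0, 1) (b j)) (\<lambda>j. consl (-1, 0) (b j)) j l
    = consl (0, 0) (minor q a b j l)"
  using assms(2)
  by (simp add: minor_def multilinear consl_mult qrow_rewrite[OF assms])

lemma minor_lower:
  assumes "qrow q a" "q \<noteq> 0" "j \<in> {1..3}" "l \<in> {1..3}" "j < l"
  shows "minor q (\<lambda>j. consl (1, 0) (a j)) (\<lambda>j. consl (0, 1) (a j) + consl (-1, 0) (b j)) j l
    = consl (0, 0) (minor q a b j l)"
  using assms(2)
  by (simp add: minor_def multilinear consl_mult qrow_rewrite[OF assms])

lemma minor_consl_left:
  "minor q (\<lambda>j. consl p (a j)) (\<lambda>j. consl (0, 0) (c j)) j l = consl p (minor q a c j l)"
  and minor_consl_right: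
  "minor q (\<lambda>j. consl (0, 0) (c j)) (\<lambda>j. consl p (a j)) j l = consl p (minor q c a j l)"
  by (cases p; simp add: minor_def multilinear consl_mult)+

lemma minor_add_left: "minor q (\<lambda>j. a j + b j) c j l = minor q a c j l + minor q b c j l"
  and minor_add_right: "minor q c (\<lambda>j. a j + b j) j l = minor q c a j l + minor q c b j l"
  by (simp_all add: minor_def multilinear)

text \<open>The expansion along the first row, chosen so that the letters \<open>2\<close> and
  \<open>-2\<close> affect only the minors.\<close>

definition det3 :: "complex \<Rightarrow> row \<Rightarrow> row \<Rightarrow> row \<Rightarrow> ((int \<times> int) list \<Rightarrow>\<^sub>0 complex)" where
  "det3 q a b c = lmul q (a 1) (minor q b c 2 3) - smul q (lmul q (a 2) (minor q b c 1 3))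
     + smul (q\<^sup>2) (lmul q (a 3) (minor q b c 1 2))"

lemma det3_consl:
  "(\<And>j l. j \<in> {1..3} \<Longrightarrow> l \<in> {1..3} \<Longrightarrow> j < l \<Longrightarrow> minor q a' b' j l = consl (0, 0) (minor q a b j l))
   \<Longrightarrow> det3 q (\<lambda>j. consl (0, 0) (c j)) a' b' = consl (0, 0) (det3 q c a b)"
  by (simp add: det3_def multilinear consl_mult)

text \<open>The row of the expansion itself changes here, so products are regrouped until
  \<open>b_j b_k\<close> meets \<open>q b_k b_j\<close>. Associativity is a hypothesis because it is
  supplied only for elements of one carrier \<open>Lq q m\<close>.\<close>

lemma det3_upper:
  assumes "qrow q b" "q \<noteq> 0"
    and assoc: "\<And>j k l. lmul q (b j) (lmul q (b k) (c l)) = lmul q (lmul q (b j) (b k)) (c l)"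
  shows "det3 q (\<lambda>j. consl (1, 0) (a j) + consl (0, 1) (b j)) (\<lambda>j. consl (-1, 0) (b j)) (\<lambda>j. consl (0, 0) (c j))
    = consl (0, 0) (det3 q a b c)"
  using assms(2)
  by (simp add: det3_def minor_def multilinear consl_mult assoc qrow_rewrite[OF assms(1,2)])
     (rule poly_mapping_eqI, simp add: lookup_add lookup_minus field_simps power2_eq_square)

lemma det3_lower:
  assumes "qrow q a" "q \<noteq> 0"
    and assoc: "\<And>j k l. lmul q (a j) (lmul q (a k) (c l)) = lmul q (lmul q (a j) (a k)) (c l)"
  shows "det3 q (\<lambda>j. consl (1, 0) (a j)) (\<lambda>j. consl (0, 1) (a j) + consl (-1, 0) (b j)) (\<lambda>j. consl (0, 0) (c j))
    = consl (0, 0) (det3 q a b c)"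
  using assms(2)
  by (simp add: det3_def minor_def multilinear consl_mult assoc qrow_rewrite[OF assms(1,2)])
     (rule poly_mapping_eqI, simp add: lookup_add lookup_minus field_simps power2_eq_square)

section \<open>The matrix of a word\<close>

lemma atLeastAtMost_1_3: "{1..3::nat} = {1, 2, 3}"
  by auto

abbreviation T_row :: "int list \<Rightarrow> nat \<Rightarrow> row" where
  "T_row is i \<equiv> \<lambda>j. T_mat is (i, j)"

abbreviation letters :: "int set" where
  "letters \<equiv> {1, -1, 2, -2}"

lemma T_row_Cons:
  "T_row (1 # is) 1 = (\<lambda>j. consl (1, 0) (T_row is 1 j) + consl (0, 1) (T_row is 2 j))"
  "T_row (1 # is) 2 = (\<lambda>j. consl (-1, 0) (T_row is 2 j))"
  "T_row (1 # is) 3 = (\<lambda>j. consl (0, 0) (T_row is 3 j))"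
  "T_row (-1 # is) 1 = (\<lambda>j. consl (1, 0) (T_row is 1 j))"
  "T_row (-1 # is) 2 = (\<lambda>j. consl (0, 1) (T_row is 1 j) + consl (-1, 0) (T_row is 2 j))"
  "T_row (-1 # is) 3 = (\<lambda>j. consl (0, 0) (T_row is 3 j))"
  "T_row (2 # is) 1 = (\<lambda>j. consl (0, 0) (T_row is 1 j))"
  "T_row (2 # is) 2 = (\<lambda>j. consl (1, 0) (T_row is 2 j) + consl (0, 1) (T_row is 3 j))"
  "T_row (2 # is) 3 = (\<lambda>j. consl (-1, 0) (T_row is 3 j))"
  "T_row (-2 # is) 1 = (\<lambda>j. consl (0, 0) (T_row is 1 j))"
  "T_row (-2 # is) 2 = (\<lambda>j. consl (1, 0) (T_row is 2 j))"
  "T_row (-2 # is) 3 = (\<lambda>j. consl (0, 1) (T_row is 2 j) + consl (-1, 0) (T_row is 3 j))"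
  by (simp_all add: fun_eq_iff atLeastAtMost_1_3 psi_gen_def lin_0[OF lin_tensor_cons_left]
      del: One_nat_def)

definition quantum_matrix :: "complex \<Rightarrow> (nat \<Rightarrow> row) \<Rightarrow> bool" where
  "quantum_matrix q M \<longleftrightarrow> qrow q (M 1) \<and> qrow q (M 2) \<and> qrow q (M 3) \<and>
     qpair q (M 1) (M 2) \<and> qpair q (M 1) (M 3) \<and> qpair q (M 2) (M 3)"

lemma quantum_matrix_T:
  assumes "q \<noteq> 0" "set is \<subseteq> letters"
  shows "quantum_matrix q (T_row is)"
  using assms(2)
proof (induction "is")
  case Nil
  show ?case
    unfolding quantum_matrix_def qrow_def qpair_def atLeastAtMost_1_3
    by (simp add: multilinear)
next
  case (Cons s "is")
  then have IH: "qrow q (T_row is 1)" "qrow q (T_row is 2)" "qrow q (T_row is 3)"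
    "qpair q (T_row is 1) (T_row is 2)" "qpair q (T_row is 1) (T_row is 3)"
    "qpair q (T_row is 2) (T_row is 3)"
    by (auto simp: quantum_matrix_def)
  from Cons.prems consider "s = 1" | "s = -1" | "s = 2" | "s = -2" by auto
  then show ?case
    by cases
       (simp_all only: quantum_matrix_def T_row_Cons,
        (intro conjI qrow_upper qrow_lower qpair_upper qpair_lower qrow_consl
          qpair_add_left qpair_add_right qpair_consl_left qpair_consl_right IH assms(1))+)
qed

lemma det3_T:
  assumes "q \<noteq> 0" "set is \<subseteq> letters"
  shows "det3 q (T_row is 1) (T_row is 2) (T_row is 3) = single (replicate (length is) (0, 0)) 1"
  using assms(2)
proof (induction "is")
  case Nil
  show ?case
    by (simp add: det3_def minor_def multilinear tmul_single)
next
  case (Cons s "is")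
  interpret ring "Lq q (length is)" by (rule ring_Lq) fact
  have assoc: "lmul q (T_mat is x) (lmul q (T_mat is y) (T_mat is z))
      = lmul q (lmul q (T_mat is x) (T_mat is y)) (T_mat is z)" for x y z
    using m_assoc[OF T_mat_closed T_mat_closed T_mat_closed, of x y z] by (simp add: Lq_simps)
  have IH: "qrow q (T_row is 1)" "qrow q (T_row is 2)" "qrow q (T_row is 3)"
    using quantum_matrix_T[OF assms(1), of "is"] Cons.prems by (auto simp: quantum_matrix_def)
  from Cons.prems consider "s = 1" | "s = -1" | "s = 2" | "s = -2" by auto
  then have "det3 q (T_row (s # is) 1) (T_row (s # is) 2) (T_row (s # is) 3)
      = consl (0, 0) (det3 q (T_row is 1) (T_row is 2) (T_row is 3))"
  proof cases
    case 1
    show ?thesis unfolding 1 T_row_Cons by (rule det3_upper[OF IH(2) assms(1) assoc])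
  next
    case 2
    show ?thesis unfolding 2 T_row_Cons by (rule det3_lower[OF IH(1) assms(1) assoc])
  next
    case 3
    show ?thesis unfolding 3 T_row_Cons
      by (rule det3_consl) (rule minor_upper[OF IH(3) assms(1)])
  next
    case 4
    show ?thesis unfolding 4 T_row_Cons
      by (rule det3_consl) (rule minor_lower[OF IH(2) assms(1)])
  qed
  with Cons show ?case by simp
qed

section \<open>Descent to the quotient\<close>

lemma perm_length_alt:
  "perm_length w = (if w 2 < w 1 then 1 else 0) + (if w 3 < w 1 then 1 else 0) + (if w 3 < w 2 then 1 else 0)"
proof -
  have "{(i, j). i \<in> {1..3} \<and> j \<in> {1..3} \<and> i < j \<and> w j < w i}
      = {(1, 2), (1, 3), (2, 3)} \<inter> {p. w (snd p) < w (fst p)}"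
    by (auto simp: atLeastAtMost_1_3)
  moreover have "card ({(1, 2), (1, 3), (2, 3)} \<inter> {p. w (snd p) < w (fst p)})
      = (\<Sum>p\<in>{(1, 2), (1, 3), (2, 3)}. if w (snd p) < w (fst p) then 1 else 0)"
    by (simp only: sum.If_cases finite.intros) simp
  ultimately have "perm_length w
      = (\<Sum>p\<in>{(1, 2), (1, 3), (2, 3)}. if w (snd p) < w (fst p) then 1 else 0)"
    by (simp only: perm_length_def)
  then show ?thesis by simp
qed

lemma hom_ext_X:
  assumes "q \<noteq> 0"
  shows "hom_ext (Lq q (length is)) (T_mat is) (X i j) = T_mat is (i, j)"
proof -
  interpret ring "Lq q (length is)" by (rule ring_Lq) fact
  show ?thesis using r_one[OF T_mat_closed] by (simp add: X_def hom_ext_single)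
qed

lemma hom_ext_T_mult:
  assumes "q \<noteq> 0"
  shows "hom_ext (Lq q (length is)) (T_mat is) (f \<otimes>\<^bsub>free_alg\<^esub> g)
    = lmul q (hom_ext (Lq q (length is)) (T_mat is) f) (hom_ext (Lq q (length is)) (T_mat is) g)"
  using hom_ext_mult[OF Lq_twisted_algebra ring_Lq[OF assms], where \<phi> = "T_mat is", OF T_mat_closed]
  by (simp add: Lq_simps)

lemma hom_ext_T_one: "hom_ext (Lq q (length is)) (T_mat is) \<one>\<^bsub>free_alg\<^esub> = \<one>\<^bsub>Lq q (length is)\<^esub>"
  by (simp add: free_alg_simps hom_ext_single)

lemma X_closed: "i \<in> {1..3} \<Longrightarrow> j \<in> {1..3} \<Longrightarrow> X i j \<in> carrier free_alg"
  by (simp add: X_def free_alg_simps)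

lemma free_alg_mult_closed:
  "f \<in> carrier free_alg \<Longrightarrow> g \<in> carrier free_alg \<Longrightarrow> f \<otimes>\<^bsub>free_alg\<^esub> g \<in> carrier free_alg"
  by (rule monoid.m_closed[OF ring.is_monoid[OF ring_free_alg]])

lemma free_alg_smul_closed: "f \<in> carrier free_alg \<Longrightarrow> smul c f \<in> carrier free_alg"
  by (auto simp: free_alg_simps in_keys_iff)

lemma free_alg_diff_closed: "f \<in> carrier free_alg \<Longrightarrow> g \<in> carrier free_alg \<Longrightarrow> f - g \<in> carrier free_alg"
  unfolding free_alg_simps by (auto dest!: subsetD[OF Poly_Mapping.keys_diff] dest: subsetD)

lemma free_alg_sum_closed: "(\<And>x. x \<in> A \<Longrightarrow> f x \<in> carrier free_alg) \<Longrightarrow> sum f A \<in> carrier free_alg"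
  using Poly_Mapping.keys_sum[of f A] unfolding free_alg_simps by blast

lemma quantum_det_closed: "quantum_det q \<in> carrier free_alg"
  unfolding quantum_det_def
proof (rule free_alg_sum_closed)
  fix \<tau> assume "\<tau> \<in> {\<tau>. \<tau> permutes {1..3::nat}}"
  then have "\<tau> i \<in> {1..3} \<longleftrightarrow> i \<in> {1..3}" for i using permutes_in_image[of \<tau> "{1..3}" i] by simp
  then show "smul ((- q) ^ perm_length \<tau>)
     (X 1 (\<tau> 1) \<otimes>\<^bsub>free_alg\<^esub> X 2 (\<tau> 2) \<otimes>\<^bsub>free_alg\<^esub> X 3 (\<tau> 3)) \<in> carrier free_alg"
    by (intro free_alg_smul_closed free_alg_mult_closed X_closed) simp_all
qed

lemma sum_permutations_3:
  "(\<Sum>\<tau>\<in>{\<tau>. \<tau> permutes {1..3}}. f (\<tau> 1) (\<tau> 2) (\<tau> (3::nat)) (perm_length \<tau>)) =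
     f 1 2 3 0 + f 1 3 2 1 + f 2 1 3 1 + f 2 3 1 2 + f 3 1 2 2 + (f 3 2 1 3 :: 'a :: comm_monoid_add)"
proof -
  have 3: "{\<tau>. \<tau> permutes {3::nat}} = {id}" by auto
  show ?thesis
    unfolding atLeastAtMost_1_3
    by (simp add: sum_over_permutations_insert 3 perm_length_alt Transposition.transpose_def add_ac
        eval_nat_numeral)
qed

lemma hom_ext_quantum_det:
  assumes "q \<noteq> 0"
  shows "hom_ext (Lq q (length is)) (T_mat is) (quantum_det q)
    = det3 q (T_row is 1) (T_row is 2) (T_row is 3)"
proof -
  interpret ring "Lq q (length is)" by (rule ring_Lq) fact
  have assoc: "lmul q (lmul q (T_mat is x) (T_mat is y)) (T_mat is z)
      = lmul q (T_mat is x) (lmul q (T_mat is y) (T_mat is z))" for x y z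
    using m_assoc[OF T_mat_closed T_mat_closed T_mat_closed, of x y z] by (simp add: Lq_simps)
  have "hom_ext (Lq q (length is)) (T_mat is) (quantum_det q)
    = (\<Sum>\<tau>\<in>{\<tau>. \<tau> permutes {1..3}}. smul ((- q) ^ perm_length \<tau>)
        (lmul q (lmul q (T_mat is (1, \<tau> 1)) (T_mat is (2, \<tau> 2))) (T_mat is (3, \<tau> 3))))"
    by (simp add: quantum_det_def lin_sum[OF lin_hom_ext] lin_smul[OF lin_hom_ext]
        hom_ext_T_mult[OF assms] hom_ext_X[OF assms])
  also have "\<dots> = det3 q (T_row is 1) (T_row is 2) (T_row is 3)"
    unfolding sum_permutations_3[of "\<lambda>i j k n. smul ((- q) ^ n)
      (lmul q (lmul q (T_mat is (1, i)) (T_mat is (2, j))) (T_mat is (3, k)))"]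
    by (simp add: det3_def minor_def assoc multilinear)
       (rule poly_mapping_eqI, simp add: lookup_add lookup_minus algebra_simps power2_eq_square power3_eq_cube)
  finally show ?thesis .
qed

lemma quantum_matrix_cases:
  assumes "quantum_matrix q M"
  shows "i \<in> {1..3} \<Longrightarrow> qrow q (M i)"
    and "i \<in> {1..3} \<Longrightarrow> k \<in> {1..3} \<Longrightarrow> i < k \<Longrightarrow> qpair q (M i) (M k)"
  using assms unfolding quantum_matrix_def atLeastAtMost_1_3 by auto

lemma hom_ext_relators:
  assumes "q \<noteq> 0" "set is \<subseteq> letters" "r \<in> relators q"
  shows "hom_ext (Lq q (length is)) (T_mat is) r = 0"
proof -
  note hom = lin_diff[OF lin_hom_ext] lin_smul[OF lin_hom_ext] hom_ext_T_mult[OF assms(1)]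
    hom_ext_X[OF assms(1)] hom_ext_quantum_det[OF assms(1)] hom_ext_T_one
  note qm = quantum_matrix_cases[OF quantum_matrix_T[OF assms(1,2)]]
  have rel:
    "\<lbrakk>i \<in> {1..3}; j \<in> {1..3}; l \<in> {1..3}; j < l\<rbrakk>
      \<Longrightarrow> lmul q (T_mat is (i, j)) (T_mat is (i, l)) = smul q (lmul q (T_mat is (i, l)) (T_mat is (i, j)))"
    "\<lbrakk>i \<in> {1..3}; k \<in> {1..3}; j \<in> {1..3}; i < k\<rbrakk>
      \<Longrightarrow> lmul q (T_mat is (i, j)) (T_mat is (k, j)) = smul q (lmul q (T_mat is (k, j)) (T_mat is (i, j)))"
    "\<lbrakk>i \<in> {1..3}; k \<in> {1..3}; j \<in> {1..3}; l \<in> {1..3}; i < k; j < l\<rbrakk>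
      \<Longrightarrow> lmul q (T_mat is (i, l)) (T_mat is (k, j)) = lmul q (T_mat is (k, j)) (T_mat is (i, l))"
    "\<lbrakk>i \<in> {1..3}; k \<in> {1..3}; j \<in> {1..3}; l \<in> {1..3}; i < k; j < l\<rbrakk>
      \<Longrightarrow> lmul q (T_mat is (i, j)) (T_mat is (k, l)) - lmul q (T_mat is (k, l)) (T_mat is (i, j))
        = smul (q - inverse q) (lmul q (T_mat is (i, l)) (T_mat is (k, j)))" for i j k l
    using qm(1)[of i] qm(2)[of i k] unfolding qrow_def qpair_def by blast+
  show ?thesis
    using assms(3) unfolding relators_def Un_iff
  proof (elim disjE)
    assume "r \<in> {quantum_det q - \<one>\<^bsub>free_alg\<^esub>}"
    then show ?thesis using det3_T[OF assms(1,2)] by (simp add: hom Lq_simps)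
  qed (auto simp: hom rel(1,2,4) intro: rel(3) simp del: atLeastAtMost_iff One_nat_def)
qed

lemma relators_closed: "relators q \<subseteq> carrier free_alg"
proof -
  have "\<one>\<^bsub>free_alg\<^esub> \<in> carrier free_alg" by (simp add: free_alg_simps)
  then show ?thesis
    unfolding relators_def
    by (auto intro!: free_alg_diff_closed free_alg_smul_closed free_alg_mult_closed X_closed quantum_det_closed
        simp del: atLeastAtMost_iff)
qed

text \<open>A kernel is a two-sided ideal; containing the relators, it contains the ideal that they
  generate.\<close>

lemma hom_ext_Idl:
  assumes "q \<noteq> 0" "set is \<subseteq> letters" "r \<in> Idl\<^bsub>free_alg\<^esub> (relators q)"
  shows "hom_ext (Lq q (length is)) (T_mat is) r = 0"
proof -
  let ?L = "Lq q (length is)" and ?h = "hom_ext (Lq q (length is)) (T_mat is)"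
  have "ring_hom_ring free_alg ?L ?h"
  proof (rule ring_hom_ringI2[OF ring_free_alg ring_Lq[OF assms(1)]], rule ring_hom_memI)
    show "?h f \<in> carrier ?L" for f
      by (rule hom_ext_closed[OF Lq_twisted_algebra ring_Lq[OF assms(1)] T_mat_closed])
  qed (simp_all only: hom_ext_T_one hom_ext_T_mult[OF assms(1)] Lq_simps(1,5) free_alg_simps(4)
        lin_add[OF lin_hom_ext])
  then have "ideal (a_kernel free_alg ?L ?h) free_alg"
    by (rule ring_hom_ring.kernel_is_ideal)
  moreover have "relators q \<subseteq> a_kernel free_alg ?L ?h"
    using relators_closed hom_ext_relators[OF assms(1,2)]
    by (auto simp: a_kernel_def' Lq_simps)
  ultimately have "Idl\<^bsub>free_alg\<^esub> (relators q) \<subseteq> a_kernel free_alg ?L ?h"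
    by (rule ring.genideal_minimal[OF ring_free_alg])
  then show ?thesis using assms(3) by (auto simp: a_kernel_def' Lq_simps)
qed

text \<open>\<open>the_elem\<close> returns a meaningful value only on a singleton: the map is
  constant on the coset, and the coset contains \<open>f\<close>.\<close>

lemma pi_tilde_coset:
  assumes "q \<noteq> 0" "set is \<subseteq> letters" "f \<in> carrier free_alg"
  shows "pi_tilde q is ((Idl\<^bsub>free_alg\<^esub> (relators q)) +>\<^bsub>free_alg\<^esub> f) = pi_free q is f"
proof -
  interpret ring free_alg by (rule ring_free_alg)
  let ?I = "Idl\<^bsub>free_alg\<^esub> (relators q)"
  interpret I: ideal ?I free_alg by (rule genideal_ideal[OF relators_closed])
  have coset: "?I +>\<^bsub>free_alg\<^esub> f = {r + f | r. r \<in> ?I}"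
    by (auto simp: a_r_coset_def' free_alg_simps)
  have "pi_free q is (r + f) = pi_free q is f" if "r \<in> ?I" for r
    using hom_ext_Idl[OF assms(1,2) that]
    by (simp add: pi_free_eq[OF assms(1)] lin_add[OF lin_hom_ext])
  moreover have "f \<in> ?I +>\<^bsub>free_alg\<^esub> f"
    by (rule I.a_rcos_self) fact
  ultimately have "pi_free q is ` (?I +>\<^bsub>free_alg\<^esub> f) = {pi_free q is f}"
    by (force simp: coset)
  then show ?thesis by (simp add: pi_tilde_def)
qed

text \<open>This removes the quotient: from here on elements of \<open>R_alg\<close> are exhibited
  by representatives in the free algebra.\<close>

lemma R_alg_eq:
  assumes "q \<noteq> 0" "set is \<subseteq> letters"
  shows "R_alg q is = pi_free q is ` carrier free_alg"
  using pi_tilde_coset[OF assms]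
  by (force simp: R_alg_def Cq_SL3_def FactRing_def A_RCOSETS_def')

section \<open>Path expansions\<close>

text \<open>A list instead of a set keeps multiplicities, so concatenation is addition even when a
  monomial is repeated.\<close>

definition path_sum :: "(int \<times> int) list list \<Rightarrow> ((int \<times> int) list \<Rightarrow>\<^sub>0 complex)" where
  "path_sum ps = (\<Sum>p\<leftarrow>ps. single p 1)"

lemma lookup_path_sum: "lookup (path_sum ps) p = of_nat (count_list ps p)"
  by (induction ps) (simp_all add: path_sum_def lookup_add lookup_single when_def)

text \<open>Coefficients are counts, and a positive integer is nonzero in the complex numbers, so
  paths never cancel.\<close>

lemma keys_path_sum: "keys (path_sum ps) = set ps"
  by (auto simp: in_keys_iff lookup_path_sum count_list_0_iff)

lemma path_sum_simps [simp]:
  "path_sum [] = 0"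
  "path_sum (ps @ rs) = path_sum ps + path_sum rs"
  "path_sum (map ((#) u) ps) = consl u (path_sum ps)"
proof -
  show "path_sum (map ((#) u) ps) = consl u (path_sum ps)"
    by (induction ps) (simp_all add: path_sum_def multilinear)
qed (simp_all add: path_sum_def)

text \<open>A path is a nonzero term in the expansion of the matrix product \<open>T_mat\<close>.\<close>

fun paths :: "int list \<Rightarrow> nat \<Rightarrow> nat \<Rightarrow> (int \<times> int) list list" where
  "paths [] i j = (if i = j then [[]] else [])"
| "paths (s # is) i j = (let h = nat \<bar>s\<bar> in
     map ((#) (if i = h then 1 else if i = h + 1 then -1 else 0, 0)) (paths is i j) @
     (if s > 0 \<and> i = h then map ((#) (0, 1)) (paths is (h + 1) j)
      else if s < 0 \<and> i = h + 1 then map ((#) (0, 1)) (paths is h j)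
      else []))"

lemma length_paths: "p \<in> set (paths is i j) \<Longrightarrow> length p = length is"
  by (induction "is" i j arbitrary: p rule: paths.induct) (auto simp: Let_def split: if_splits)

lemma path_sum_Cons:
  "path_sum (paths (1 # is) 1 j) = consl (1, 0) (path_sum (paths is 1 j)) + consl (0, 1) (path_sum (paths is 2 j))"
  "path_sum (paths (1 # is) 2 j) = consl (-1, 0) (path_sum (paths is 2 j))"
  "path_sum (paths (1 # is) 3 j) = consl (0, 0) (path_sum (paths is 3 j))"
  "path_sum (paths (-1 # is) 1 j) = consl (1, 0) (path_sum (paths is 1 j))"
  "path_sum (paths (-1 # is) 2 j) = consl (0, 1) (path_sum (paths is 1 j)) + consl (-1, 0) (path_sum (paths is 2 j))"
  "path_sum (paths (-1 # is) 3 j) = consl (0, 0) (path_sum (paths is 3 j))"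
  "path_sum (paths (2 # is) 1 j) = consl (0, 0) (path_sum (paths is 1 j))"
  "path_sum (paths (2 # is) 2 j) = consl (1, 0) (path_sum (paths is 2 j)) + consl (0, 1) (path_sum (paths is 3 j))"
  "path_sum (paths (2 # is) 3 j) = consl (-1, 0) (path_sum (paths is 3 j))"
  "path_sum (paths (-2 # is) 1 j) = consl (0, 0) (path_sum (paths is 1 j))"
  "path_sum (paths (-2 # is) 2 j) = consl (1, 0) (path_sum (paths is 2 j))"
  "path_sum (paths (-2 # is) 3 j) = consl (0, 1) (path_sum (paths is 2 j)) + consl (-1, 0) (path_sum (paths is 3 j))"
  by (simp_all add: add.commute eval_nat_numeral)

lemma T_mat_paths:
  assumes "set is \<subseteq> letters" "i \<in> {1, 2, 3}"
  shows "T_row is i j = path_sum (paths is i j)"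
  using assms
proof (induction "is" arbitrary: i)
  case Nil
  then show ?case by (simp add: path_sum_def)
next
  case (Cons s "is")
  then have IH: "T_row is i j = path_sum (paths is i j)" if "i \<in> {1, 2, 3}" for i
    using that by simp
  from Cons.prems have "s = 1 \<or> s = -1 \<or> s = 2 \<or> s = -2" "i = 1 \<or> i = 2 \<or> i = 3"
    by auto
  then show ?case
    by (elim disjE)
       (simp_all only: T_row_Cons[unfolded fun_eq_iff, rule_format] path_sum_Cons IH insert_iff simp_thms)
qed

section \<open>Minors as path sums of the dual word\<close>

definition index_pair :: "nat \<Rightarrow> nat \<times> nat" where
  "index_pair i = (if i = 1 then (1, 2) else if i = 2 then (1, 3) else (2, 3))"

text \<open>The letters \<open>1\<close> and \<open>-1\<close> mix rows 1 and 2, hence the pairs {1,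
  3} and {2, 3}, numbered 2 and 3 by \<open>index_pair\<close>; likewise \<open>2\<close> and
  \<open>-2\<close> mix the pairs numbered 1 and 2. This numbering preserves the direction of the
  row operation, so the sign stays and \<open>paths\<close> serves for minors too.\<close>

definition dual_letter :: "int \<Rightarrow> int" where
  "dual_letter s = sgn s * (3 - \<bar>s\<bar>)"

definition T_minor :: "complex \<Rightarrow> int list \<Rightarrow> nat \<Rightarrow> row" where
  "T_minor q is i j = minor q (T_row is (fst (index_pair i))) (T_row is (snd (index_pair i)))
     (fst (index_pair j)) (snd (index_pair j))"

lemma index_pair_simps [simp]:
  "index_pair 1 = (1, 2)" "index_pair (Suc 0) = (1, 2)" "index_pair 2 = (1, 3)" "index_pair 3 = (2, 3)"
  by (simp_all add: index_pair_def)

lemma index_pair_bounds: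
  assumes "j \<in> {1, 2, 3}"
  shows "fst (index_pair j) \<in> {1..3}" "snd (index_pair j) \<in> {1..3}"
    "fst (index_pair j) < snd (index_pair j)"
  using assms by auto

lemma qrow_T:
  assumes "q \<noteq> 0" "set is \<subseteq> letters"
  shows "qrow q (T_row is 1)" "qrow q (T_row is 2)" "qrow q (T_row is 3)"
  using quantum_matrix_T[OF assms] by (auto simp: quantum_matrix_def)

text \<open>The 2-minors span the dual representation, in which the two simple roots are exchanged.\<close>

lemma T_minor_Cons:
  assumes "q \<noteq> 0" "set is \<subseteq> letters" "j \<in> {1, 2, 3}"
  shows
  "T_minor q (1 # is) 1 j = consl (0, 0) (T_minor q is 1 j)"
  "T_minor q (1 # is) 2 j = consl (1, 0) (T_minor q is 2 j) + consl (0, 1) (T_minor q is 3 j)"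
  "T_minor q (1 # is) 3 j = consl (-1, 0) (T_minor q is 3 j)"
  "T_minor q (-1 # is) 1 j = consl (0, 0) (T_minor q is 1 j)"
  "T_minor q (-1 # is) 2 j = consl (1, 0) (T_minor q is 2 j)"
  "T_minor q (-1 # is) 3 j = consl (0, 1) (T_minor q is 2 j) + consl (-1, 0) (T_minor q is 3 j)"
  "T_minor q (2 # is) 1 j = consl (1, 0) (T_minor q is 1 j) + consl (0, 1) (T_minor q is 2 j)"
  "T_minor q (2 # is) 2 j = consl (-1, 0) (T_minor q is 2 j)"
  "T_minor q (2 # is) 3 j = consl (0, 0) (T_minor q is 3 j)"
  "T_minor q (-2 # is) 1 j = consl (1, 0) (T_minor q is 1 j)"
  "T_minor q (-2 # is) 2 j = consl (0, 1) (T_minor q is 1 j) + consl (-1, 0) (T_minor q is 2 j)"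
  "T_minor q (-2 # is) 3 j = consl (0, 0) (T_minor q is 3 j)"
  unfolding T_minor_def index_pair_simps fst_conv snd_conv T_row_Cons
    minor_upper[OF qrow_T(2)[OF assms(1,2)] assms(1) index_pair_bounds[OF assms(3)]]
    minor_upper[OF qrow_T(3)[OF assms(1,2)] assms(1) index_pair_bounds[OF assms(3)]]
    minor_lower[OF qrow_T(1)[OF assms(1,2)] assms(1) index_pair_bounds[OF assms(3)]]
    minor_lower[OF qrow_T(2)[OF assms(1,2)] assms(1) index_pair_bounds[OF assms(3)]]
  by (simp_all only: minor_consl_left minor_consl_right minor_add_left minor_add_right)

lemma T_minor_paths:
  assumes "q \<noteq> 0" "set is \<subseteq> letters" "i \<in> {1, 2, 3}" "j \<in> {1, 2, 3}"
  shows "T_minor q is i j = path_sum (paths (map dual_letter is) i j)"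
  using assms(2,3)
proof (induction "is" arbitrary: i)
  case Nil
  with assms(4) show ?case
    by (auto simp: T_minor_def minor_def path_sum_def multilinear tmul_single)
next
  case (Cons s "is")
  then have IH: "T_minor q is i j = path_sum (paths (map dual_letter is) i j)"
    if "i \<in> {1, 2, 3}" for i
    using that by simp
  have "set is \<subseteq> letters" using Cons.prems by simp
  note rec = T_minor_Cons[OF assms(1) this assms(4)]
  have dual: "dual_letter 1 = 2" "dual_letter (-1) = -2" "dual_letter 2 = 1" "dual_letter (-2) = -1"
    by (simp_all add: dual_letter_def)
  from Cons.prems have "s = 1 \<or> s = -1 \<or> s = 2 \<or> s = -2" "i = 1 \<or> i = 2 \<or> i = 3"
    by auto
  then show ?case
    by (elim disjE) (simp_all only: rec list.map dual path_sum_Cons IH insert_iff simp_thms)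
qed

section \<open>Certificates\<close>

text \<open>The arguments of \<open>Minor\<close> are numbers of pairs as in
  \<open>index_pair\<close>: \<open>Minor 2 2\<close> has rows 1, 3 and columns 1, 3.\<close>

datatype entry = Entry nat nat | Minor nat nat

fun entry_valid :: "entry \<Rightarrow> bool" where
  "entry_valid (Entry i j) \<longleftrightarrow> i \<in> {1, 2, 3} \<and> j \<in> {1, 2, 3}"
| "entry_valid (Minor i j) \<longleftrightarrow> i \<in> {1, 2, 3} \<and> j \<in> {1, 2, 3}"

fun entry_paths :: "int list \<Rightarrow> entry \<Rightarrow> (int \<times> int) list list" where
  "entry_paths is (Entry i j) = paths is i j"
| "entry_paths is (Minor i j) = paths (map dual_letter is) i j"

lemma length_entry_paths: "p \<in> set (entry_paths is e) \<Longrightarrow> length p = length is"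
  by (cases e) (auto dest: length_paths)

lemma entry_in_R_alg:
  assumes "q \<noteq> 0" "set is \<subseteq> letters" "entry_valid e"
  shows "path_sum (entry_paths is e) \<in> R_alg q is"
proof (cases e)
  case (Entry i j)
  then have ij: "i \<in> {1, 2, 3}" "j \<in> {1, 2, 3}" using assms(3) by auto
  have "pi_free q is (X i j) \<in> R_alg q is"
    unfolding R_alg_eq[OF assms(1,2)]
    by (intro imageI X_closed) (use ij in auto)
  then show ?thesis
    using T_mat_paths[OF assms(2) ij(1)] assms(1) by (simp add: Entry pi_free_eq hom_ext_X)
next
  case (Minor i j)
  then have ij: "i \<in> {1, 2, 3}" "j \<in> {1, 2, 3}" using assms(3) by auto
  obtain i1 i2 j1 j2 where pr: "index_pair i = (i1, i2)" "index_pair j = (j1, j2)"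
    by (metis surj_pair)
  have "pi_free q is (X i1 j1 \<otimes>\<^bsub>free_alg\<^esub> X i2 j2 - smul q (X i1 j2 \<otimes>\<^bsub>free_alg\<^esub> X i2 j1))
      \<in> R_alg q is"
    unfolding R_alg_eq[OF assms(1,2)]
    by (intro imageI free_alg_diff_closed free_alg_smul_closed free_alg_mult_closed X_closed)
       (use ij pr in auto)
  also have "pi_free q is (X i1 j1 \<otimes>\<^bsub>free_alg\<^esub> X i2 j2 - smul q (X i1 j2 \<otimes>\<^bsub>free_alg\<^esub> X i2 j1))
      = T_minor q is i j"
    by (simp add: T_minor_def minor_def pr pi_free_eq[OF assms(1)] lin_diff[OF lin_hom_ext]
        lin_smul[OF lin_hom_ext] hom_ext_T_mult[OF assms(1)] hom_ext_X[OF assms(1)])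
  finally show ?thesis
    using T_minor_paths[OF assms(1,2) ij] by (simp add: Minor)
qed

lemma R_alg_mult:
  assumes "q \<noteq> 0" "set is \<subseteq> letters" "r \<in> R_alg q is" "r' \<in> R_alg q is"
  shows "lmul q r r' \<in> R_alg q is"
proof -
  obtain f f' where f: "f \<in> carrier free_alg" "f' \<in> carrier free_alg"
    and r: "r = pi_free q is f" "r' = pi_free q is f'"
    using assms(3,4) unfolding R_alg_eq[OF assms(1,2)] by blast
  have "lmul q r r' = pi_free q is (f \<otimes>\<^bsub>free_alg\<^esub> f')"
    using assms(1) by (simp add: r pi_free_eq hom_ext_T_mult)
  then show ?thesis
    using free_alg_mult_closed[OF f] by (simp add: R_alg_eq[OF assms(1,2)])
qed

lemma R_alg_one:
  assumes "q \<noteq> 0" "set is \<subseteq> letters"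
  shows "single (replicate (length is) (0, 0)) 1 \<in> R_alg q is"
  unfolding R_alg_eq[OF assms]
proof (rule image_eqI)
  show "single (replicate (length is) (0, 0)) 1 = pi_free q is \<one>\<^bsub>free_alg\<^esub>"
    using assms(1) by (simp add: pi_free_eq hom_ext_T_one Lq_simps)
qed (simp add: free_alg_simps)

section \<open>Monomials and the exponent vectors of \<open>S_set\<close>\<close>

lemma prod_twist_nonzero: "q \<noteq> 0 \<Longrightarrow> prod_list (map2 (xy_twist q) us vs) \<noteq> 0"
  by (induction us vs rule: list_induct2') (auto simp: xy_twist_def)

lemma map_fst_xy_mult:
  "length us = length vs \<Longrightarrow> map fst (map2 xy_mult us vs) = map2 (+) (map fst us) (map fst vs)"
  by (induction us vs rule: list_induct2) auto

lemma single_in_Units: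
  assumes "q \<noteq> 0" "c \<noteq> 0" "length p = m"
  shows "single p c \<in> Units (Lq q m)"
proof -
  let ?neg = "map (\<lambda>(a, b). (- a, - b)) p"
  let ?t = "prod_list (map2 (xy_twist q) p ?neg)"
  have "?t \<noteq> 0" using prod_twist_nonzero[OF assms(1)] .
  \<comment> \<open>The twist of \<open>(a, b)\<close> and \<open>(-a, -b)\<close> is
    \<open>q^(a b)\<close> in either order, so one scalar serves both the left and the right
    inverse.\<close>
  moreover have "prod_list (map2 (xy_twist q) ?neg p) = ?t"
    by (induction p) (auto simp: xy_twist_def)
  moreover have "map2 xy_mult p ?neg = replicate m (0, 0)" "map2 xy_mult ?neg p = replicate m (0, 0)"
    unfolding assms(3)[symmetric] by (induction p) auto
  ultimately have "lmul q (single ?neg (inverse (c * ?t))) (single p c) = single (replicate m (0, 0)) 1"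
    "lmul q (single p c) (single ?neg (inverse (c * ?t))) = single (replicate m (0, 0)) 1"
    using assms(2) by (simp_all only: tmul_single) (simp_all add: field_simps)
  moreover have "single p c \<in> carrier (Lq q m)" "single ?neg (inverse (c * ?t)) \<in> carrier (Lq q m)"
    using assms(3) by (simp_all add: Lq_simps)
  ultimately show ?thesis
    unfolding Units_def Lq_simps(1,3) by blast
qed

definition exponent_sum :: "int list \<Rightarrow> entry list \<Rightarrow> int list" where
  "exponent_sum is es =
     foldr (\<lambda>e. map2 (+) (map fst (hd (entry_paths is e)))) es (replicate (length is) 0)"

text \<open>A product of monomials is a monomial up to a power of \<open>q\<close>, hence a unit
  that stays in \<open>R_alg\<close>. Each factor has exactly one path, so \<open>hd\<close> in
  \<open>exponent_sum\<close> loses nothing.\<close>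

lemma exponent_sum_in_supp:
  assumes "q \<noteq> 0" "set is \<subseteq> letters"
    and "\<forall>e\<in>set es. entry_valid e \<and> length (entry_paths is e) = 1"
  shows "length (exponent_sum is es) = length is \<and> exponent_sum is es \<in> (\<Union>v\<in>S_set q is. supp_x v)"
proof -
  have "\<exists>p c. c \<noteq> 0 \<and> length p = length is \<and> map fst p = exponent_sum is es \<and> single p c \<in> R_alg q is"
    using assms(3)
  proof (induction es)
    case Nil
    then show ?case
      using R_alg_one[OF assms(1,2)]
      by (intro exI[of _ "replicate (length is) (0, 0)"] exI[of _ 1]) (simp add: exponent_sum_def)
  next
    case (Cons e es)
    then obtain p c where IH: "c \<noteq> 0" "length p = length is" "map fst p = exponent_sum is es"
      "single p c \<in> R_alg q is" by auto
    from Cons.prems obtain r where r: "entry_paths is e = [r]"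
      by (auto simp: length_Suc_conv)
    have len: "length r = length is" using length_entry_paths[of r "is" e] by (simp add: r)
    have "single r 1 \<in> R_alg q is"
      using entry_in_R_alg[OF assms(1,2), of e] Cons.prems by (simp add: r path_sum_def)
    from R_alg_mult[OF assms(1,2) this IH(4)]
    have "single (map2 xy_mult r p) (prod_list (map2 (xy_twist q) r p) * c) \<in> R_alg q is"
      by (simp add: tmul_single)
    moreover have "map fst (map2 xy_mult r p) = exponent_sum is (e # es)"
      using len IH(2,3) by (subst map_fst_xy_mult) (simp_all add: exponent_sum_def r)
    ultimately show ?case
      using IH(1,2) len prod_twist_nonzero[OF assms(1), of r p]
      by (intro exI[of _ "map2 xy_mult r p"] exI[of _ "prod_list (map2 (xy_twist q) r p) * c"]) auto
  qed
  then obtain p c where p: "c \<noteq> 0" "length p = length is" "map fst p = exponent_sum is es"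
    "single p c \<in> R_alg q is" by auto
  then have "single p c \<in> S_set q is"
    using single_in_Units[OF assms(1)] by (simp add: S_set_def)
  moreover have "exponent_sum is es \<in> supp_x (single p c)"
    using p by (simp add: supp_x_def)
  moreover have "length (exponent_sum is es) = length is"
    using p(2) by (simp flip: p(3))
  ultimately show ?thesis by blast
qed

section \<open>A finite test for pivot elements\<close>

definition pivot_path :: "int list \<Rightarrow> nat list \<Rightarrow> nat \<Rightarrow> (int \<times> int) list list \<Rightarrow> bool" where
  "pivot_path a I k ps \<longleftrightarrow> list_ex (\<lambda>c.
     list_all (\<lambda>j. a ! j * fst (c ! j) \<le> 0) I \<and> a ! k * fst (c ! k) < 0 \<and>
     list_all (\<lambda>p. p = c \<or>
       (list_all (\<lambda>j. a ! j * (fst (p ! j) - fst (c ! j)) \<ge> 0) I \<and>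
        a ! k * (fst (p ! k) - fst (c ! k)) > 0)) ps) ps"

text \<open>\<open>pivot_path\<close> demands the strict inequality at \<open>k\<close> from every
  other path, not just from every other exponent vector. Hence no other path shares the x-exponents
  of \<open>c\<close>, which gives multiplicity 1.\<close>

lemma pivot_element_path_sum:
  assumes "pivot_path a I k ps" "\<And>p. p \<in> set ps \<Longrightarrow> length p = m" "k < m" "set I \<subseteq> {..<m}"
  shows "pivot_element a (set I) k (path_sum ps)"
proof -
  from assms(1) obtain c where c: "c \<in> set ps"
    and neg: "\<forall>j\<in>set I. a ! j * fst (c ! j) \<le> 0" "a ! k * fst (c ! k) < 0"
    and other: "\<And>p. p \<in> set ps \<Longrightarrow> p \<noteq> c \<Longrightarrow>
      (\<forall>j\<in>set I. a ! j * (fst (p ! j) - fst (c ! j)) \<ge> 0) \<and> a ! k * (fst (p ! k) - fst (c ! k)) > 0"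
    by (auto simp: pivot_path_def list_ex_iff list_all_iff)
  have nth: "map fst p ! j = fst (p ! j)" if "p \<in> set ps" "j < m" for p j
    using that assms(2) by simp
  have uniq: "p = c" if "p \<in> set ps" "map fst p = map fst c" for p
    using other[OF that(1)] nth[OF that(1) assms(3)] nth[OF c assms(3)] that(2) by force
  have "{t \<in> keys (path_sum ps). map fst t = map fst c} = {c}"
    using c uniq by (auto simp: keys_path_sum)
  then have "x_multiplicity (path_sum ps) (map fst c) = 1"
    by (simp add: x_multiplicity_def)
  moreover have "map fst c \<in> supp_x (path_sum ps)"
    using c by (simp add: supp_x_def keys_path_sum)
  moreover have "(\<forall>j\<in>set I. a ! j * (c' ! j - map fst c ! j) \<ge> 0) \<and> a ! k * (c' ! k - map fst c ! k) > 0"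
    if "c' \<in> supp_x (path_sum ps) - {map fst c}" for c'
  proof -
    from that obtain p where p: "p \<in> set ps" "c' = map fst p" "p \<noteq> c"
      by (auto simp: supp_x_def keys_path_sum)
    show ?thesis
      using other[OF p(1,3)] nth[OF p(1)] nth[OF c] assms(3,4) unfolding p(2) by auto
  qed
  moreover have "(\<forall>j\<in>set I. a ! j * map fst c ! j \<le> 0) \<and> a ! k * map fst c ! k < 0"
    using neg nth[OF c] assms(3,4) by auto
  ultimately show ?thesis unfolding pivot_element_def by blast
qed

text \<open>
  A certificate consists of a reduced word, of entries and minors that are monomials and whose product
  has the exponent vector \<open>a\<close>, common to all \<open>k\<close>, and of the list of the \<open>n\<^sub>k\<close> (counted from 0) with their
  pivot elements.
\<close>

type_synonym certificate = "int list \<times> entry list \<times> (nat \<times> entry) list"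

fun certificate_valid :: "certificate \<Rightarrow> bool" where
  "certificate_valid (is, es, ps) \<longleftrightarrow>
     (let m = length is; a = exponent_sum is es; ns = map fst ps in
      list_all (\<lambda>s. s = 1 \<or> s = -1 \<or> s = 2 \<or> s = -2) is \<and>
      list_all (\<lambda>e. entry_valid e \<and> length (entry_paths is e) = 1) es \<and>
      list_all (\<lambda>t. t \<noteq> 0) a \<and>
      length ns = m \<and> distinct ns \<and> list_all (\<lambda>n. n < m) ns \<and>
      list_all (\<lambda>k. entry_valid (snd (ps ! k)) \<and>
        pivot_path a (drop k ns) (ns ! k) (entry_paths is (snd (ps ! k)))) [0..<m])"

lemma enough_pivot_elements_certificate:
  assumes "q \<noteq> 0" "certificate_valid (is, es, ps)"
  shows "enough_pivot_elements q is"
proof -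
  define m a ns where defs: "m = length is" "a = exponent_sum is es" "ns = map fst ps"
  note cert = assms(2)[unfolded certificate_valid.simps Let_def, folded defs, unfolded list_all_iff]
  from cert have "is": "set is \<subseteq> letters" by auto
  have a: "length a = m" "a \<in> (\<Union>v\<in>S_set q is. supp_x v)" "0 \<notin> set a"
    using exponent_sum_in_supp[OF assms(1) "is", of es] cert by (auto simp: defs(1,2))
  from cert have ns: "length ns = m" "distinct ns" "set ns \<subseteq> {..<m}" by auto
  have "card (set ns) = card {..<m}" using ns by (simp add: distinct_card)
  with ns(3) have set_ns: "set ns = {..<m}" by (simp add: card_subset_eq)
  \<comment> \<open>\<open>permutes\<close> asks for a function on all naturals that fixes
    everything from \<open>m\<close> on.\<close>
  define n where "n k = (if k < m then ns ! k else k)" for k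
  have "bij_betw ((!) ns) {..<m} {..<m}"
    by (rule bij_betw_nth) (simp_all only: ns set_ns)
  then have "bij_betw n {..<m} {..<m}"
    by (rule bij_betw_cong[THEN iffD1, rotated]) (simp add: n_def)
  then have "n permutes {..<m}"
    by (rule bij_imp_permutes) (simp add: n_def)
  moreover have "\<exists>u\<in>R_alg q is. pivot_element a ({..<m} - n ` {..<k}) (n k) u" if k: "k < m" for k
  proof -
    let ?ps = "entry_paths is (snd (ps ! k))"
    \<comment> \<open>The indices used up before step \<open>k\<close> are the first
      \<open>k\<close> members of \<open>ns\<close>; those still in play form
      \<open>drop k ns\<close>, which begins with the current one.\<close>
    have "n ` {..<k} = (!) ns ` {0..<k}"
      using k by (intro image_cong) (auto simp: n_def)
    also have "\<dots> = set (take k ns)"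
      using k ns(1) by (intro nth_image) simp
    finally have "n ` {..<k} = set (take k ns)" .
    moreover have "set ns = set (take k ns) \<union> set (drop k ns)"
      by (metis append_take_drop_id set_append)
    moreover have "set (take k ns) \<inter> set (drop k ns) = {}"
      using ns(2) by (metis append_take_drop_id distinct_append)
    ultimately have I: "{..<m} - n ` {..<k} = set (drop k ns)" using set_ns by auto
    have "pivot_element a (set (drop k ns)) (ns ! k) (path_sum ?ps)"
    proof (rule pivot_element_path_sum)
      show "pivot_path a (drop k ns) (ns ! k) ?ps" using cert k by simp
      show "length p = m" if "p \<in> set ?ps" for p
        using length_entry_paths[OF that] by (simp add: defs)
      show "ns ! k < m" using nth_mem[of k ns] set_ns ns(1) k by blast
      show "set (drop k ns) \<subseteq> {..<m}" using ns(3) set_drop_subset by fastforce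
    qed
    moreover have "path_sum ?ps \<in> R_alg q is"
      using cert k by (intro entry_in_R_alg[OF assms(1) "is"]) simp
    ultimately show ?thesis using k unfolding I by (auto simp: n_def)
  qed
  ultimately show ?thesis
    unfolding enough_pivot_elements_def Let_def defs(1)[symmetric] using a by blast
qed

text \<open>Found by computer search.\<close>

definition certificates :: "certificate list" where
  "certificates = [
    ([], [], []),
    ([1], [Entry 1 1], [(0, Entry 2 2)]),
    ([2], [Entry 2 2], [(0, Entry 3 3)]),
    ([1, 2], [Entry 2 2], [(0, Entry 1 1), (1, Entry 3 3)]),
    ([2, 1], [Entry 2 2], [(0, Entry 3 3), (1, Entry 1 1)]),
    ([1, 2, 1], [Entry 2 2], [(0, Entry 1 1), (1, Entry 3 3), (2, Entry 1 1)]),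
    ([-1], [Entry 1 1], [(0, Entry 2 2)]),
    ([-1, 1], [Entry 1 1], [(0, Entry 2 2), (1, Entry 2 2)]),
    ([-1, 2], [Entry 2 2], [(0, Entry 1 1), (1, Entry 3 3)]),
    ([-1, 1, 2], [Minor 2 2], [(0, Entry 2 2), (1, Entry 2 2), (2, Entry 1 2)]),
    ([-1, 2, 1], [Minor 2 2], [(0, Entry 2 2), (1, Entry 2 2), (2, Entry 2 2)]),
    ([-1, 1, 2, 1], [Minor 2 2],
      [(0, Entry 2 2), (1, Entry 2 2), (2, Entry 1 2), (3, Entry 1 2)]),
    ([-2], [Entry 2 2], [(0, Entry 3 3)]),
    ([-2, 1], [Entry 2 2], [(0, Entry 3 3), (1, Entry 1 1)]),
    ([-2, 2], [Entry 2 2], [(0, Entry 3 3), (1, Entry 3 3)]),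
    ([-2, 1, 2], [Entry 2 2], [(0, Entry 3 3), (1, Entry 1 1), (2, Entry 3 3)]),
    ([-2, 2, 1], [Entry 2 2], [(0, Entry 3 3), (1, Entry 3 3), (2, Entry 1 1)]),
    ([-2, 1, 2, 1], [Entry 2 2],
      [(0, Entry 3 3), (1, Entry 1 1), (2, Entry 3 3), (3, Entry 1 1)]),
    ([-1, -2], [Entry 2 2], [(0, Entry 1 1), (1, Entry 3 3)]),
    ([-1, -2, 1], [Minor 2 2], [(0, Entry 2 2), (1, Entry 2 2), (2, Entry 2 2)]),
    ([-1, -2, 2], [Entry 2 2], [(0, Entry 1 1), (1, Entry 3 3), (2, Entry 3 3)]),
    ([-1, -2, 1, 2], [Entry 3 2, Minor 2 3],
      [(1, Minor 1 2), (2, Entry 2 1), (0, Entry 2 3), (3, Entry 3 3)]),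
    ([-1, -2, 2, 1], [Entry 1 1, Minor 1 1],
      [(1, Entry 3 3), (0, Entry 2 3), (2, Entry 3 3), (3, Entry 2 2)]),
    ([-1, -2, 1, 2, 1], [Entry 1 3, Entry 3 2, Minor 1 1],
      [(1, Entry 3 3), (2, Entry 2 1), (0, Entry 2 3), (3, Entry 3 3), (4, Entry 1 1)]),
    ([-2, -1], [Entry 2 2], [(0, Entry 3 3), (1, Entry 1 1)]),
    ([-2, -1, 1], [Minor 2 2], [(0, Minor 1 1), (1, Entry 2 2), (2, Entry 2 2)]),
    ([-2, -1, 2], [Entry 2 2], [(0, Entry 3 3), (1, Entry 1 1), (2, Entry 3 3)]),
    ([-2, -1, 1, 2], [Entry 1 1, Minor 1 1],
      [(1, Minor 3 3), (0, Minor 2 3), (2, Entry 2 3), (3, Entry 3 3)]),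
    ([-2, -1, 2, 1], [Entry 2 3, Minor 3 2],
      [(1, Entry 1 2), (2, Entry 3 2), (0, Entry 3 3), (3, Entry 2 2)]),
    ([-2, -1, 1, 2, 1], [Entry 1 1, Entry 2 1, Minor 3 2],
      [(1, Entry 3 2), (2, Entry 3 2), (3, Entry 1 2), (0, Entry 3 3), (4, Entry 1 2)]),
    ([-1, -2, -1], [Entry 2 2], [(0, Entry 1 1), (1, Entry 3 3), (2, Entry 1 1)]),
    ([-1, -2, -1, 1], [Minor 2 2],
      [(1, Minor 1 1), (2, Entry 2 2), (3, Entry 2 2), (0, Entry 2 1)]),
    ([-1, -2, -1, 2], [Entry 2 2],
      [(0, Entry 1 1), (1, Entry 3 3), (2, Entry 1 1), (3, Entry 3 3)]),
    ([-1, -2, -1, 1, 2], [Entry 1 1, Entry 1 2, Minor 2 3],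
      [(1, Minor 1 2), (2, Entry 2 3), (3, Entry 2 3), (0, Entry 2 1), (4, Entry 3 3)]),
    ([-1, -2, -1, 2, 1], [Entry 2 3, Entry 3 1, Minor 1 1],
      [(0, Entry 1 2), (1, Entry 3 3), (2, Entry 1 2), (3, Entry 3 3), (4, Entry 2 2)]),
    ([-1, 1, -2, 2, -1, 1], [Minor 1 2, Minor 2 1],
      [(2, Entry 3 3), (0, Entry 2 3), (1, Entry 2 3), (3, Entry 3 3), (4, Entry 1 2), (5, Entry 1 2)])]"

section \<open>Reduced words in S_3 and the final assembly\<close>

definition reduced_words :: "int list list" where
  "reduced_words = [[], [1], [2], [1, 2], [2, 1], [1, 2, 1]]"

text \<open>No \<open>q\<close> occurs in \<open>certificate_valid\<close>: this is one finite
  computation with integer lists, valid for all parameters.\<close>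

lemma certificates_valid: "list_all certificate_valid certificates"
  by code_simp

text \<open>A shuffle of a word for \<open>w1\<close>, taken with negative signs, and a word for
  \<open>w2\<close> expresses the pair, so the six words on each side give 36 cases to look
  up.\<close>

lemma certificates_complete:
  "\<forall>u\<in>set reduced_words. \<forall>v\<in>set reduced_words. \<exists>c\<in>set certificates.
     map abs (filter (\<lambda>s. s < 0) (fst c)) = u \<and> filter (\<lambda>s. s > 0) (fst c) = v"
  by code_simp

text \<open>There is one word for each of the six permutations; of the two for the longest,
  \<open>[1, 2, 1]\<close> is the listed one. Permutations are functions on all naturals, so points
  outside \<open>{1, 2, 3}\<close> are compared separately.\<close>

lemma permutes_3_word:
  assumes "w permutes {1..3}"
  shows "\<exists>u\<in>set reduced_words. simple_prod u = w \<and> length u = perm_length w"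
proof -
  have outside: "w x = x" if "x \<notin> {1, 2, 3}" for x
    using assms that unfolding atLeastAtMost_1_3 by (rule permutes_not_in)
  have "w 1 \<in> {1, 2, 3}" "w 2 \<in> {1, 2, 3}" "w 3 \<in> {1, 2, 3}"
    using permutes_in_image[OF assms] unfolding atLeastAtMost_1_3 by simp_all
  moreover have "w 1 \<noteq> w 2" "w 1 \<noteq> w 3" "w 2 \<noteq> w 3"
    using permutes_inj[OF assms] by (auto simp: inj_eq)
  ultimately consider
    "w 1 = 1" "w 2 = 2" "w 3 = 3" | "w 1 = 2" "w 2 = 1" "w 3 = 3" | "w 1 = 1" "w 2 = 3" "w 3 = 2"
    | "w 1 = 2" "w 2 = 3" "w 3 = 1" | "w 1 = 3" "w 2 = 1" "w 3 = 2" | "w 1 = 3" "w 2 = 2" "w 3 = 1"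
    by auto
  then have "\<exists>u\<in>set reduced_words. length u = perm_length w \<and>
      simple_prod u 1 = w 1 \<and> simple_prod u 2 = w 2 \<and> simple_prod u 3 = w 3"
    by cases (simp_all add: reduced_words_def simple_prod_def perm_length_alt Transposition.transpose_def
        eval_nat_numeral)
  then obtain u where "u \<in> set reduced_words" "length u = perm_length w"
    "simple_prod u 1 = w 1" "simple_prod u 2 = w 2" "simple_prod u 3 = w 3"
    by blast
  moreover from this(1) have "simple_prod u x = x" if "x \<notin> {1, 2, 3}" for x
    using that by (auto simp: reduced_words_def simple_prod_def Transposition.transpose_def)
  then have "simple_prod u x = w x" if "x \<notin> {1, 2, 3}" for x
    using that outside by simp
  ultimately have "simple_prod u x = w x" for x
    by (cases "x \<in> {1, 2, 3}") auto
  then show ?thesis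
    using \<open>u \<in> set reduced_words\<close> \<open>length u = perm_length w\<close> by (intro bexI[of _ u]) auto
qed

lemma simple_prod_abs: "simple_prod (map abs is) = simple_prod is"
  by (simp add: simple_prod_def foldr_map o_def)

theorem mainTheorem11:
  fixes q :: complex and w1 w2 :: "nat \<Rightarrow> nat"
  assumes "q \<noteq> 0"
    and "\<forall>n::nat. n > 0 \<longrightarrow> q ^ n \<noteq> 1"
    and "w1 permutes {1..3}"
    and "w2 permutes {1..3}"
  shows "\<exists>is. reduced_expression w1 w2 is \<and> enough_pivot_elements q is"
proof -
  obtain u v where u: "u \<in> set reduced_words" "simple_prod u = w1" "length u = perm_length w1"
    and v: "v \<in> set reduced_words" "simple_prod v = w2" "length v = perm_length w2"
    using permutes_3_word[OF assms(3)] permutes_3_word[OF assms(4)] by blast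
  obtain "is" es ps where c: "(is, es, ps) \<in> set certificates"
    "map abs (filter (\<lambda>s. s < 0) is) = u" "filter (\<lambda>s. s > 0) is = v"
    using certificates_complete u(1) v(1) by fastforce
  have valid: "certificate_valid (is, es, ps)"
    using certificates_valid c(1) by (auto simp: list_all_iff)
  then have letters: "set is \<subseteq> {1, -1, 2, -2}"
    by (auto simp: Let_def list_all_iff)
  \<comment> \<open>No letter is zero, so the letters that are not negative are the positive ones,
    and the two lengths add up to that of the word.\<close>
  then have "filter (\<lambda>s. \<not> s < 0) is = filter (\<lambda>s. s > 0) is"
    by (intro filter_cong) auto
  then have "length is = length u + length v"
    using sum_length_filter_compl[of "\<lambda>s. s < 0" "is"] by (simp flip: c(2,3))
  moreover have "simple_prod (filter (\<lambda>s. s < 0) is) = w1"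
    using u(2) simple_prod_abs[of "filter (\<lambda>s. s < 0) is"] by (simp add: c(2))
  ultimately have "reduced_expression w1 w2 is"
    using letters u v c by (simp add: reduced_expression_def)
  then show ?thesis
    using enough_pivot_elements_certificate[OF assms(1) valid] by blast
qed

end
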